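(* There exist constants $c,C>0$ such that, if a linear ordering of $[n]=\{0,1,\ldots,n-1\}$ is chosen uniformly at random among the $n!$ linear orderings and $\sigma_n$ denotes the cyclic permutation of $[n]$ it induces, then the probability that $$c\,n^2\le \mu(\sigma_n)\le C\,n^2$$ tends to $1$ as $n\to\infty$, where $\mu$ denotes the meander number. In particular, there exist cyclic permutations satisfying these inequalities for all $n$, and thus $\mu_n=\Theta(n^2)$, where $\mu_n$ is the largest $\mu(\sigma)$ among all cyclic permutations $\sigma$ of $[n]$.
   Context: A cyclic permutation $\sigma$ of $[n]=\{0,1,\ldots,n-1\}$ is a permutation consisting of a single $n$-cycle; it is written in cycle notation $\sigma=(\sigma_0,\sigma_1,\ldots,\sigma_{n-1})$, a listing of all elements of $[n]$ understood up to cyclic rotation. A linear ordering $(\sigma_0,\ldots,\sigma_{n-1})$ of $[n]$ induces the cyclic permutation with this cycle notation. Meander number. A set of pairs of elements of $[N]$ is non-crossing if it does not contain two pairs $\{a_1,b_1\},\{a_2,b_2\}$ with $a_1<a_2<b_1<b_2$. For $N$ even and positive, a cyclic permutation $\tau=(\tau_0,\ldots,\tau_{N-1})$ of $[N]$ is cyclic meandric if the two alternating matchings $\{\{\tau_0,\tau_1\},\{\tau_2,\tau_3\},\ldots,\{\tau_{N-2},\tau_{N-1}\}\}$ and $\{\{\tau_1,\tau_2\},\{\tau_3,\tau_4\},\ldots,\{\tau_{N-1},\tau_0\}\}$ are both non-crossing. For $S\subset[N]$, the first-return permutation of $\tau$ on $S$ is obtained by reading $\tau$ cyclically, deleting all letters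 outside $S$, and relabelling the elements of $S$ increasingly by $0,\ldots,|S|-1$; it is a cyclic permutation of $[|S|]$. The meander number $\mu(\sigma)$ of a cyclic permutation $\sigma$ of $[n]$ is the least even $N$ for which there is a cyclic meandric permutation of $[N]$ whose first-return permutation on some $n$-element subset of $[N]$ is $\sigma$. $\mu_n=\Theta(n^2)$ means there are positive constants $c',C'$ with $c'n^2\le\mu_n\le C'n^2$ for all sufficiently large $n$. *)

theory Defs
  imports
    "HOL-Combinatorics.Cycles"
    "HOL-Combinatorics.Orbits"
    "HOL-Combinatorics.Multiset_Permutations"
    "HOL-Probability.Probability_Mass_Function"
    "HOL-Library.Landau_Symbols"
begin

definition cyclic_perm :: "nat \<Rightarrow> (nat \<Rightarrow> nat) \<Rightarrow> bool" where
  "cyclic_perm n \<sigma> \<longleftrightarrow> \<sigma> permutes {..<n} \<and> cyclic_on \<sigma> {..<n}"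

text \<open>
  A cycle notation is determined only up to rotation; the representative starting at 0 is used.
  Neither notion below that is built on it depends on this choice: rotating the list by one
  position exchanges its two alternating matchings, and it rotates (or fixes) every filtered list,
  which does not affect the value of \<^const>\<open>cycle_of_list\<close>.
\<close>

definition cycle_notation :: "nat \<Rightarrow> (nat \<Rightarrow> nat) \<Rightarrow> nat list" where
  "cycle_notation n \<sigma> = map (\<lambda>i. (\<sigma> ^^ i) 0) [0..<n]"

definition noncrossing :: "nat set set \<Rightarrow> bool" where
  "noncrossing M \<longleftrightarrow>
     \<not> (\<exists>a1 b1 a2 b2. {a1, b1} \<in> M \<and> {a2, b2} \<in> M \<and> a1 < a2 \<and> a2 < b1 \<and> b1 < b2)"

definition even_matching :: "nat list \<Rightarrow> nat set set" where
  "even_matching ts = {{ts ! (2 * i), ts ! (2 * i + 1)} | i. i < length ts div 2}"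

definition odd_matching :: "nat list \<Rightarrow> nat set set" where
  "odd_matching ts =
     {{ts ! (2 * i + 1), ts ! ((2 * i + 2) mod length ts)} | i. i < length ts div 2}"

definition cyclic_meandric :: "nat \<Rightarrow> (nat \<Rightarrow> nat) \<Rightarrow> bool" where
  "cyclic_meandric N \<tau> \<longleftrightarrow>
     even N \<and> N > 0 \<and> cyclic_perm N \<tau> \<and>
     noncrossing (even_matching (cycle_notation N \<tau>)) \<and>
     noncrossing (odd_matching (cycle_notation N \<tau>))"

text \<open>The increasing relabelling of \<open>S\<close> sends \<open>x \<in> S\<close> to the number of smaller elements of \<open>S\<close>.\<close>

definition first_return :: "nat \<Rightarrow> (nat \<Rightarrow> nat) \<Rightarrow> nat set \<Rightarrow> nat \<Rightarrow> nat" where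
  "first_return N \<tau> S =
     cycle_of_list
       (map (\<lambda>x. card {y \<in> S. y < x}) (filter (\<lambda>x. x \<in> S) (cycle_notation N \<tau>)))"

definition meander_number :: "nat \<Rightarrow> (nat \<Rightarrow> nat) \<Rightarrow> nat" where
  "meander_number n \<sigma> =
     (LEAST N. even N \<and> (\<exists>\<tau> S. cyclic_meandric N \<tau> \<and> S \<subseteq> {..<N} \<and> card S = n \<and>
                                first_return N \<tau> S = \<sigma>))"

definition max_meander_number :: "nat \<Rightarrow> nat" where
  "max_meander_number n = Max {meander_number n \<sigma> | \<sigma>. cyclic_perm n \<sigma>}"

end

theory Submission
  imports Defs
begin

text \<open>
  Upper bound: on an \<open>M \<times> M\<close> grid, with \<open>M\<close> even, a line running boustrophedon through the rows and a
  curve running boustrophedon through the columns form a meander. Marking in column \<open>j\<close> the crossing with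
  row \<open>xs ! j\<close> gives a first-return permutation with cycle notation \<open>xs\<close>, so \<open>O(n\<^sup>2)\<close> crossings suffice
  for every cyclic permutation.

  Lower bound: line and curve of a meander with \<open>N\<close> crossings form a 4-regular plane graph. A planar
  separator argument splits its \<open>n\<close> marked crossings into two parts of linear size such that line and
  curve together switch between the parts only \<open>O(\<surd>N)\<close> times. Hence some \<open>A \<subseteq> {..<n}\<close> of linear size
  has \<open>O(\<surd>N)\<close> switches both along \<open>0, 1, \<dots>, n - 1\<close> and along \<open>xs\<close>. If \<open>N\<close> is below a small multiple of
  \<open>n\<^sup>2\<close>, a union bound over the possible \<open>A\<close> and switching patterns shows that an exponentially small
  proportion of the orderings \<open>xs\<close> admits such a set.
\<close>

section \<open>Breadth-first trees\<close>

text \<open>Planarity is handled combinatorially: a bounded face is named by its outermost arc, and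
  the separator argument sees only a count of faces and a sum that telescopes around each face. The
  bounds meet at order n^2 for a reason of entropy. Two 0-1 words of length n with at most \<delta>
  n switches leave at most exp(\<epsilon> n) choices up to a constant factor, with \<epsilon> small
  for small \<delta>, whereas prescribing where a balanced \<open>A\<close> sits along an ordering
  costs a factor that decays exponentially in n at a fixed rate. What must be balanced is the marked
  set, not the set of all crossings, because the marks may be distributed arbitrarily among the
  crossings. Probabilities are counted over lists, so no rotations are divided out; passing between
  two lists with the same cycle costs one extra switch.\<close>

definition cut_edges :: "('e \<Rightarrow> 'v) \<Rightarrow> ('e \<Rightarrow> 'v) \<Rightarrow> 'e set \<Rightarrow> 'v set \<Rightarrow> 'e set" where
  "cut_edges L R E Z = {e \<in> E. (L e \<in> Z) \<noteq> (R e \<in> Z)}"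

text \<open>Used for the faces of a plane graph, with \<open>L\<close> and \<open>R\<close> the
  sides of an edge, and again for its vertices, with \<open>src\<close> and \<open>tgt\<close> in
  their place. \<open>lipschitz\<close> is what breadth-first search adds to an arbitrary rooted
  tree: depth changes by at most 1 along every edge, also outside the tree.\<close>

locale bfs_tree =
  fixes F :: "'f set" and E :: "'e set" and L R :: "'e \<Rightarrow> 'f"
    and rt :: 'f and d :: "'f \<Rightarrow> nat" and pe :: "'f \<Rightarrow> 'e" and p :: "'f \<Rightarrow> 'f"
  assumes root_in: "rt \<in> F" and d_root: "d rt = 0" and p_root: "p rt = rt"
    and pe_in: "\<lbrakk>f \<in> F; f \<noteq> rt\<rbrakk> \<Longrightarrow> pe f \<in> E"
    and p_in': "\<lbrakk>f \<in> F; f \<noteq> rt\<rbrakk> \<Longrightarrow> p f \<in> F"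
    and d_p: "\<lbrakk>f \<in> F; f \<noteq> rt\<rbrakk> \<Longrightarrow> d f = Suc (d (p f))"
    and sides_pe: "\<lbrakk>f \<in> F; f \<noteq> rt\<rbrakk> \<Longrightarrow> {L (pe f), R (pe f)} = {f, p f}"
    and lipschitz: "e \<in> E \<Longrightarrow> d (L e) \<le> Suc (d (R e)) \<and> d (R e) \<le> Suc (d (L e))"
begin

lemma p_in: "f \<in> F \<Longrightarrow> p f \<in> F"
  using p_in' p_root by (cases "f = rt") auto

lemma pk_in: "f \<in> F \<Longrightarrow> (p ^^ k) f \<in> F"
  by (induction k) (auto simp: p_in)

lemma d_pk: "f \<in> F \<Longrightarrow> d ((p ^^ k) f) = d f - k"
proof (induction k)
  case (Suc k)
  then show ?case using d_p[of "(p ^^ k) f"] pk_in[of f k]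
    by (cases "(p ^^ k) f = rt") (auto simp: p_root d_root)
qed simp

lemma inj_pe: "inj_on pe (F - {rt})"
proof (rule inj_onI)
  fix f g assume f: "f \<in> F - {rt}" and g: "g \<in> F - {rt}" and eq: "pe f = pe g"
  have "{f, p f} = {g, p g}" using sides_pe[of f] sides_pe[of g] f g eq by auto
  then have "f = g \<or> (f = p g \<and> g = p f)" by (auto simp: doubleton_eq_iff)
  then show "f = g" using d_p[of f] d_p[of g] f g by auto
qed

definition Sub :: "'f \<Rightarrow> 'f set" where
  "Sub f = {g \<in> F. \<exists>k. (p ^^ k) g = f}"

lemma self_in_Sub: "f \<in> F \<Longrightarrow> f \<in> Sub f"
  unfolding Sub_def using funpow_0[of p f] by blast

lemma Sub_subset: "Sub f \<subseteq> F"
  by (auto simp: Sub_def)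

lemma Sub_step: "g \<in> F \<Longrightarrow> p g \<in> Sub f \<Longrightarrow> g \<in> Sub f"
  unfolding Sub_def by (force simp: funpow_swap1[of p _ g] intro: exI[of _ "Suc k" for k])

lemma Sub_parent: "g \<in> Sub f \<Longrightarrow> g \<noteq> f \<Longrightarrow> p g \<in> Sub f"
proof -
  assume g: "g \<in> Sub f" and ne: "g \<noteq> f"
  then obtain k where k: "(p ^^ k) g = f" "g \<in> F" by (auto simp: Sub_def)
  with ne obtain j where "k = Suc j" by (cases k) auto
  then have "(p ^^ j) (p g) = f" using k by (simp add: funpow_swap1)
  then show ?thesis using k p_in by (auto simp: Sub_def)
qed

lemma d_Sub: "g \<in> Sub f \<Longrightarrow> d f \<le> d g"
  unfolding Sub_def using d_pk by fastforce

lemma parent_notin_Sub: "f \<in> F \<Longrightarrow> f \<noteq> rt \<Longrightarrow> p f \<notin> Sub f"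
  using d_Sub[of "p f" f] d_p[of f] by auto

lemma Sub_root: "Sub rt = F"
proof -
  have "(p ^^ d g) g = rt" if "g \<in> F" for g
    using d_pk[OF that, of "d g"] pk_in[OF that, of "d g"] d_p[of "(p ^^ d g) g"] by force
  then show ?thesis by (auto simp: Sub_def)
qed

text \<open>A fundamental cut: \<open>f\<close> is the only node of its subtree whose parent lies
  outside.\<close>

lemma tree_edge_cut_Sub:
  assumes f: "f \<in> F" "f \<noteq> rt" and g: "g \<in> F" "g \<noteq> rt"
  shows "(L (pe g) \<in> Sub f) \<noteq> (R (pe g) \<in> Sub f) \<longleftrightarrow> g = f"
proof -
  have "(L (pe g) \<in> Sub f) \<noteq> (R (pe g) \<in> Sub f) \<longleftrightarrow> (g \<in> Sub f) \<noteq> (p g \<in> Sub f)"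
    using sides_pe[OF g] by (auto simp: doubleton_eq_iff)
  also have "\<dots> \<longleftrightarrow> g = f"
    using Sub_step[OF g(1)] Sub_parent[of g f] self_in_Sub[OF f(1)] parent_notin_Sub[OF f] by blast
  finally show ?thesis .
qed

text \<open>The ancestors of \<open>g\<close> form one root path and are determined by their depth.
  This will bound the number of dual tree edges in the boundary of a separator.\<close>

lemma card_ancestors:
  assumes "g \<in> F" "a \<le> b"
  shows "finite {f. g \<in> Sub f \<and> a \<le> d f \<and> d f \<le> b}"
    "card {f. g \<in> Sub f \<and> a \<le> d f \<and> d f \<le> b} \<le> Suc (b - a)"
proof -
  have "{f. g \<in> Sub f \<and> a \<le> d f \<and> d f \<le> b} \<subseteq> (\<lambda>j. (p ^^ (d g - j)) g) ` {a..b}" (is "?A \<subseteq> ?B")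
  proof
    fix f assume "f \<in> ?A"
    then obtain k where k: "(p ^^ k) g = f" "a \<le> d f" "d f \<le> b" by (auto simp: Sub_def)
    have df: "d f = d g - k" using d_pk[OF assms(1), of k] k by simp
    show "f \<in> ?B"
    proof (cases "k \<le> d g")
      case True
      then have "f = (p ^^ (d g - d f)) g" using k df by simp
      then show ?thesis using k by auto
    next
      \<comment> \<open>Iterating beyond depth \<open>d g\<close> stays at the root, which
        \<open>p\<close> fixes.\<close>
      case False
      then have d0: "d f = 0" using df by simp
      have "f \<in> F" using k pk_in[OF assms(1)] by auto
      then have "f = rt" using d_p d0 by force
      moreover have "(p ^^ d g) g = rt"
        using d_pk[OF assms(1), of "d g"] pk_in[OF assms(1), of "d g"] d_p[of "(p ^^ d g) g"] by force
      ultimately have "f = (p ^^ (d g - d f)) g" using d0 by simp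
      then show ?thesis using k by auto
    qed
  qed
  moreover have "card ?B \<le> Suc (b - a)" using card_image_le[of "{a..b}"] assms(2)
    by (metis Suc_diff_le card_atLeastAtMost finite_atLeastAtMost)
  ultimately show "finite ?A" "card ?A \<le> Suc (b - a)"
    by (auto intro: finite_subset) (meson card_mono finite_atLeastAtMost finite_imageI le_trans)
qed

end

text \<open>Connectedness is applied to the set reachable from \<open>rt\<close>, whose cut is
  empty. The parent of a node is the last but one node on a shortest path from
  \<open>rt\<close>.\<close>

lemma bfs_tree_exists:
  assumes rt: "rt \<in> F" and sides: "\<And>e. e \<in> E \<Longrightarrow> L e \<in> F \<and> R e \<in> F"
    and conn: "\<And>Z. Z \<subseteq> F \<Longrightarrow> Z \<noteq> {} \<Longrightarrow> cut_edges L R E Z = {} \<Longrightarrow> Z = F"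
  shows "\<exists>d pe p. bfs_tree F E L R rt d pe p"
proof -
  define r where "r = {(f, g). \<exists>e\<in>E. {L e, R e} = {f, g}}"
  have rI: "(L e, R e) \<in> r" "(R e, L e) \<in> r" if "e \<in> E" for e
    using that by (auto simp: r_def)
  have rF: "g \<in> F" if "(f, g) \<in> r" for f g
    using that sides by (fastforce simp: r_def doubleton_eq_iff)
  have "r\<^sup>* `` {rt} = F"
  proof (rule conn)
    show "r\<^sup>* `` {rt} \<subseteq> F"
      using rF rt by (auto elim: rtranclE)
    show "r\<^sup>* `` {rt} \<noteq> {}" by blast
    show "cut_edges L R E (r\<^sup>* `` {rt}) = {}"
      unfolding cut_edges_def using rI by (auto intro: rtrancl_into_rtrancl)
  qed
  then have reach: "\<exists>k. (rt, f) \<in> r ^^ k" if "f \<in> F" for f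
    using that rtrancl_imp_relpow[of "(rt, f)" r] by auto
  define d where "d f = (LEAST k. (rt, f) \<in> r ^^ k)" for f
  have d: "(rt, f) \<in> r ^^ d f" if "f \<in> F" for f
    unfolding d_def by (rule LeastI_ex[OF reach[OF that]])
  have d_le: "d f \<le> k" if "(rt, f) \<in> r ^^ k" for f k
    unfolding d_def using Least_le[of "\<lambda>k. (rt, f) \<in> r ^^ k" k] that by simp
  have step: "d g \<le> Suc (d f)" if "f \<in> F" "(f, g) \<in> r" for f g
    using d_le[of g "Suc (d f)"] d[OF that(1)] that(2) by auto
  have d_root: "d rt = 0" using d_le[of rt 0] by simp
  have "\<exists>q e. f \<in> F \<longrightarrow> f \<noteq> rt \<longrightarrow> q \<in> F \<and> e \<in> E \<and> {L e, R e} = {f, q} \<and> d f = Suc (d q)" for f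
  proof (cases "f \<in> F \<and> f \<noteq> rt")
    case True
    have "d f \<noteq> 0" using d[of f] True by (intro notI) simp
    then obtain j where j: "d f = Suc j" by (cases "d f") auto
    then obtain q where q: "(rt, q) \<in> r ^^ j" "(q, f) \<in> r"
      using d[of f] True by auto
    have qF: "q \<in> F" using q(2) sides by (fastforce simp: r_def doubleton_eq_iff)
    have "d q = j" using d_le[OF q(1)] step[OF qF q(2)] j by simp
    then show ?thesis using q qF j by (auto simp: r_def doubleton_eq_iff)
  qed auto
  then obtain q e where qe: "\<And>f. f \<in> F \<Longrightarrow> f \<noteq> rt \<Longrightarrow>
      q f \<in> F \<and> e f \<in> E \<and> {L (e f), R (e f)} = {f, q f} \<and> d f = Suc (d (q f))"
    by metis
  have "bfs_tree F E L R rt d e (q(rt := rt))"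
    by unfold_locales (use qe rt d_root step sides rI in auto)
  then show ?thesis by blast
qed

section \<open>Balanced separators of 4-regular plane graphs\<close>

text \<open>
  Planarity enters through Euler's formula and the assumption \<open>facial\<close>: \<open>L e\<close> and \<open>R e\<close> are the faces to
  the left and right of \<open>e\<close>, and differences of a function on the vertices sum to 0 around every face.
  The assumption \<open>local\<close> says that the faces around a vertex \<open>v\<close> are at dual distance at most 2 from \<open>\<phi> v\<close>.
\<close>

locale plane_graph =
  fixes V :: "'v set" and F :: "'f set" and E :: "'e set"
    and src tgt :: "'e \<Rightarrow> 'v" and L R :: "'e \<Rightarrow> 'f" and \<phi> :: "'v \<Rightarrow> 'f"
  assumes finite: "finite V" "finite F" "finite E"
    and ends: "e \<in> E \<Longrightarrow> src e \<in> V \<and> tgt e \<in> V"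
    and sides: "e \<in> E \<Longrightarrow> L e \<in> F \<and> R e \<in> F"
    and card_E: "card E = 2 * card V" and card_F: "card F = card V + 2"
    and facial: "\<And>x :: 'v \<Rightarrow> int. f \<in> F \<Longrightarrow>
      (\<Sum>e\<in>E. (x (tgt e) - x (src e)) * (of_bool (L e = f) - of_bool (R e = f))) = 0"
    and connected_V: "\<lbrakk>X \<subseteq> V; X \<noteq> {}; cut_edges src tgt E X = {}\<rbrakk> \<Longrightarrow> X = V"
    and connected_F: "\<lbrakk>Z \<subseteq> F; Z \<noteq> {}; cut_edges L R E Z = {}\<rbrakk> \<Longrightarrow> Z = F"
    and degree: "v \<in> V \<Longrightarrow> card {e \<in> E. src e = v \<or> tgt e = v} \<le> 4"
    and local: "\<And>d :: 'f \<Rightarrow> nat.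
      \<lbrakk>\<And>e. e \<in> E \<Longrightarrow> d (L e) \<le> Suc (d (R e)) \<and> d (R e) \<le> Suc (d (L e));
       e \<in> E; v \<in> {src e, tgt e}; f \<in> {L e, R e}\<rbrakk> \<Longrightarrow> d f \<le> d (\<phi> v) + 2 \<and> d (\<phi> v) \<le> d f + 2"
begin

abbreviation cut :: "'v set \<Rightarrow> 'e set" where
  "cut \<equiv> cut_edges src tgt E"

lemma finite_cut: "finite (cut X)"
  using finite by (simp add: cut_edges_def)

text \<open>Summation of \<open>facial\<close> over \<open>Z\<close>: an edge with both sides in
  \<open>Z\<close> cancels, so only the boundary of the union of these faces contributes.\<close>

lemma facial_sum:
  fixes x :: "'v \<Rightarrow> int"
  assumes "Z \<subseteq> F"
  shows "(\<Sum>e\<in>E. (x (tgt e) - x (src e)) * (of_bool (L e \<in> Z) - of_bool (R e \<in> Z))) = 0"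
proof -
  have fZ: "finite Z" using assms finite finite_subset by blast
  have b: "of_bool (g \<in> Z) = (\<Sum>f\<in>Z. of_bool (g = f) :: int)" for g
    using fZ by (simp add: of_bool_def sum.delta')
  have "(\<Sum>e\<in>E. (x (tgt e) - x (src e)) * (of_bool (L e \<in> Z) - of_bool (R e \<in> Z)))
      = (\<Sum>e\<in>E. \<Sum>f\<in>Z. (x (tgt e) - x (src e)) * (of_bool (L e = f) - of_bool (R e = f)))"
    unfolding b by (simp add: sum_subtractf[symmetric] sum_distrib_left)
  also have "\<dots> = (\<Sum>f\<in>Z. \<Sum>e\<in>E. (x (tgt e) - x (src e)) * (of_bool (L e = f) - of_bool (R e = f)))"
    by (rule sum.swap)
  also have "\<dots> = 0" using facial assms by (intro sum.neutral) auto
  finally show ?thesis .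
qed

text \<open>
  The cut of \<open>X\<close> is dual to a closed set of edges, so besides the tree edge above \<open>f\<close> it has to leave
  the subtree of \<open>f\<close> a second time, and this can only happen through an edge outside the tree.
\<close>

lemma cut_tree_edge:
  assumes T: "bfs_tree F E L R rt d pe p"
    and f: "f \<in> F" "f \<noteq> rt" and c: "pe f \<in> cut X"
  shows "\<exists>e\<in>cut X - pe ` (F - {rt}).
    (L e \<in> bfs_tree.Sub F p f) \<noteq> (R e \<in> bfs_tree.Sub F p f)"
proof (rule ccontr)
  interpret T: bfs_tree F E L R rt d pe p by (rule T)
  assume neg: "\<not> ?thesis"
  define x :: "'v \<Rightarrow> int" where "x v = of_bool (v \<in> X)" for v
  \<comment> \<open>For \<open>e\<close> in \<open>E\<close> this term is nonzero exactly if
    \<open>e\<close> lies in the cut of \<open>X\<close> and in the dual cut of the subtree of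
    \<open>f\<close>.\<close>
  define t where "t e = (x (tgt e) - x (src e)) * (of_bool (L e \<in> T.Sub f) - of_bool (R e \<in> T.Sub f))" for e
  have "t e = 0" if e: "e \<in> E - {pe f}" for e
  proof (cases "e \<in> pe ` (F - {rt})")
    case True
    then obtain g where g: "g \<in> F" "g \<noteq> rt" "e = pe g" by auto
    with e have "g \<noteq> f" by auto
    then show ?thesis using T.tree_edge_cut_Sub[OF f g(1,2)] g(3) by (auto simp: t_def)
  next
    case False
    then show ?thesis using neg e by (auto simp: t_def x_def cut_edges_def)
  qed
  then have "(\<Sum>e\<in>E. t e) = t (pe f)"
    using finite T.pe_in[OF f] by (simp add: sum.remove[of E "pe f"])
  moreover have "(\<Sum>e\<in>E. t e) = 0"
    unfolding t_def by (rule facial_sum[OF T.Sub_subset])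
  moreover have "t (pe f) \<noteq> 0"
    using c T.tree_edge_cut_Sub[OF f f] by (auto simp: t_def x_def cut_edges_def)
  ultimately show False by simp
qed

text \<open>Tree-cotree duality: the edges not crossed by a dual spanning tree form a primal spanning tree.\<close>

lemma cotree_exists:
  assumes T: "bfs_tree F E L R rt d pe p" and r: "r \<in> V"
  defines "E' \<equiv> E - pe ` (F - {rt})"
  shows "\<exists>d' pe' p'. bfs_tree V E' src tgt r d' pe' p' \<and> pe' ` (V - {r}) = E'"
proof -
  interpret T: bfs_tree F E L R rt d pe p by (rule T)
  have TE: "pe ` (F - {rt}) \<subseteq> E" using T.pe_in by auto
  have "\<exists>d' pe' p'. bfs_tree V E' src tgt r d' pe' p'"
  proof (rule bfs_tree_exists[OF r])
    fix X assume X: "X \<subseteq> V" "X \<noteq> {}" "cut_edges src tgt E' X = {}"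
    have "cut X = {}"
    proof (rule ccontr)
      assume "cut X \<noteq> {}"
      then obtain e where e: "e \<in> cut X" by blast
      then have "e \<in> pe ` (F - {rt})" using X(3) by (auto simp: cut_edges_def E'_def)
      then obtain f where f: "f \<in> F" "f \<noteq> rt" "e = pe f" by auto
      have "cut X - pe ` (F - {rt}) = {}" using X(3) by (auto simp: cut_edges_def E'_def)
      with cut_tree_edge[OF T f(1,2), of X] e f show False by auto
    qed
    then show "X = V" using connected_V X by blast
  qed (use ends in \<open>auto simp: E'_def\<close>)
  then obtain d' pe' p' where K: "bfs_tree V E' src tgt r d' pe' p'" by blast
  interpret K: bfs_tree V E' src tgt r d' pe' p' by (rule K)
  \<comment> \<open>Euler's formula enters here: of 2 |V| edges, |V| + 1 are dual tree edges, which
    leaves |V| - 1. A spanning tree has that many edges, so it exhausts them.\<close>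
  have "card (pe ` (F - {rt})) = card F - 1"
    using card_image[OF T.inj_pe] T.root_in finite by simp
  then have "card E' = card V - 1"
    unfolding E'_def using TE finite card_E card_F by (simp add: card_Diff_subset finite_subset)
  moreover have "card (pe' ` (V - {r})) = card V - 1"
    using card_image[OF K.inj_pe] r finite by simp
  moreover have "pe' ` (V - {r}) \<subseteq> E'" using K.pe_in by auto
  ultimately have "pe' ` (V - {r}) = E'"
    using finite by (intro card_subset_eq) (auto simp: E'_def)
  with K show ?thesis by blast
qed

text \<open>Take a deepest vertex whose subtree has weight at least \<theta>. By the degree bound it
  has at most 4 children, each of weight at most \<theta> - 1, and it contributes at most 1
  itself.\<close>

lemma balanced_subtree:
  assumes K: "bfs_tree V E' src tgt r d' pe' p'" and E': "E' \<subseteq> E"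
    and Q: "Q \<subseteq> V" "4 * \<theta> < card Q" "1 \<le> \<theta>"
  shows "\<exists>v\<in>V - {r}. \<theta> \<le> card (bfs_tree.Sub V p' v \<inter> Q) \<and> card (bfs_tree.Sub V p' v \<inter> Q) \<le> 4 * \<theta>"
proof -
  interpret K: bfs_tree V E' src tgt r d' pe' p' by (rule K)
  let ?w = "\<lambda>v. card (K.Sub v \<inter> Q)"
  let ?A = "{v \<in> V. \<theta> \<le> ?w v}"
  have wr: "?w r = card Q" using K.Sub_root Q by (simp add: Int_absorb1)
  then have "r \<in> ?A" using Q K.root_in by auto
  moreover have finA: "finite ?A" using finite by auto
  ultimately have "Max (d' ` ?A) \<in> d' ` ?A" by (intro Max_in) auto
  then obtain v where v: "v \<in> ?A" "d' v = Max (d' ` ?A)" by auto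
  have vmax: "d' u \<le> d' v" if "u \<in> ?A" for u using that v finA by auto
  define C where "C = {u \<in> V - {r}. p' u = v}"
  have finC: "finite C" using finite by (auto simp: C_def)
  have small: "?w u \<le> \<theta> - 1" if "u \<in> C" for u
    using vmax[of u] K.d_p[of u] that by (force simp: C_def)
  have "pe' ` C \<subseteq> {e \<in> E. src e = v \<or> tgt e = v}"
    using K.pe_in K.sides_pe E' by (force simp: C_def doubleton_eq_iff)
  moreover have "inj_on pe' C" using K.inj_pe by (rule inj_on_subset) (auto simp: C_def)
  ultimately have "card C \<le> card {e \<in> E. src e = v \<or> tgt e = v}"
    using finite(3) by (intro card_inj_on_le[of pe']) auto
  then have C4: "card C \<le> 4" using degree[of v] v by auto
  have "K.Sub v \<subseteq> {v} \<union> (\<Union>u\<in>C. K.Sub u)"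
  proof
    fix g assume g: "g \<in> K.Sub v"
    show "g \<in> {v} \<union> (\<Union>u\<in>C. K.Sub u)"
    proof (cases "g = v")
      case False
      have gV: "g \<in> V" using g K.Sub_subset by blast
      \<comment> \<open>The node just before the first arrival at \<open>v\<close> is the child of
        \<open>v\<close> above \<open>g\<close>; taking the first arrival guarantees that this node
        is not \<open>v\<close> itself.\<close>
      define k where "k = (LEAST k. (p' ^^ k) g = v)"
      have "\<exists>k. (p' ^^ k) g = v" using g by (auto simp: K.Sub_def)
      then have k: "(p' ^^ k) g = v" unfolding k_def by (rule LeastI_ex)
      with False obtain j where j: "k = Suc j" by (cases k) auto
      let ?u = "(p' ^^ j) g"
      have "?u \<noteq> v" using not_less_Least[of j "\<lambda>k. (p' ^^ k) g = v"] j unfolding k_def by auto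
      moreover have "p' ?u = v" using k j by simp
      ultimately have "?u \<in> C" using K.p_root K.pk_in[OF gV] by (auto simp: C_def)
      moreover have "g \<in> K.Sub ?u" using gV by (auto simp: K.Sub_def)
      ultimately show ?thesis by blast
    qed auto
  qed
  then have "K.Sub v \<inter> Q \<subseteq> {v} \<union> (\<Union>u\<in>C. K.Sub u \<inter> Q)" by auto
  moreover have finQ: "finite Q" using Q finite finite_subset by blast
  ultimately have "?w v \<le> card ({v} \<union> (\<Union>u\<in>C. K.Sub u \<inter> Q))"
    using finC by (intro card_mono) auto
  also have "\<dots> \<le> 1 + card (\<Union>u\<in>C. K.Sub u \<inter> Q)"
    using card_Un_le[of "{v}"] by simp
  also have "card (\<Union>u\<in>C. K.Sub u \<inter> Q) \<le> (\<Sum>u\<in>C. ?w u)"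
    by (rule card_UN_le[OF finC])
  also have "\<dots> \<le> card C * (\<theta> - 1)"
    using small sum_bounded_above[of C ?w "\<theta> - 1"] by simp
  also have "card C * (\<theta> - 1) \<le> 4 * (\<theta> - 1)" using C4 by simp
  finally have le: "?w v \<le> 4 * \<theta>" using Q by simp
  with wr Q have "v \<noteq> r" by auto
  with le v show ?thesis by auto
qed

text \<open>Averaging: each of the 2 |V| edges is cut by at most 4 thresholds, so h consecutive
  thresholds cut at most 8 h^2 edges in total.\<close>

lemma sparse_level_cut:
  fixes lev :: "'v \<Rightarrow> nat"
  assumes lev: "\<And>e. e \<in> E \<Longrightarrow> lev (src e) \<le> lev (tgt e) + 4 \<and> lev (tgt e) \<le> lev (src e) + 4"
    and h: "0 < h" "card V \<le> h\<^sup>2"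
  shows "\<exists>r\<in>{a..<a + h}. card (cut {v \<in> V. lev v \<le> r}) \<le> 8 * h"
proof (rule ccontr)
  let ?c = "\<lambda>r. card (cut {v \<in> V. lev v \<le> r})"
  let ?P = "\<lambda>e r. (lev (src e) \<le> r) \<noteq> (lev (tgt e) \<le> r)"
  assume "\<not> ?thesis"
  then have "(\<Sum>r\<in>{a..<a + h}. 8 * h + 1) \<le> (\<Sum>r\<in>{a..<a + h}. ?c r)"
    by (intro sum_mono) (simp add: not_le Suc_le_eq)
  also have "(\<Sum>r\<in>{a..<a + h}. ?c r) = (\<Sum>r\<in>{a..<a + h}. \<Sum>e\<in>E. of_bool (?P e r))"
  proof (rule sum.cong)
    fix r
    have "cut {v \<in> V. lev v \<le> r} = E \<inter> {e. ?P e r}"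
      using ends by (auto simp: cut_edges_def)
    then show "?c r = (\<Sum>e\<in>E. of_bool (?P e r))"
      using finite(3) by (simp add: sum_of_bool_eq)
  qed simp
  also have "\<dots> = (\<Sum>e\<in>E. \<Sum>r\<in>{a..<a + h}. of_bool (?P e r))" by (rule sum.swap)
  also have "\<dots> \<le> (\<Sum>e\<in>E. 4)"
  proof (rule sum_mono)
    fix e assume "e \<in> E"
    let ?lo = "min (lev (src e)) (lev (tgt e))" and ?hi = "max (lev (src e)) (lev (tgt e))"
    have "(\<Sum>r\<in>{a..<a + h}. of_bool (?P e r) :: nat) = card ({a..<a + h} \<inter> {r. ?P e r})"
      by (simp add: sum_of_bool_eq)
    also have "\<dots> \<le> card {?lo..<?hi}" by (intro card_mono) auto
    also have "\<dots> \<le> 4" using lev[OF \<open>e \<in> E\<close>] by auto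
    finally show "(\<Sum>r\<in>{a..<a + h}. of_bool (?P e r) :: nat) \<le> 4" .
  qed
  also have "\<dots> \<le> 8 * h\<^sup>2" using h card_E by simp
  finally show False using h by (simp add: power2_eq_square algebra_simps)
qed

text \<open>
  Following Lipton and Tarjan, two sparse levels of the dual breadth-first search at distance \<open>O(h)\<close>
  enclose the median level. If neither gives a balanced cut, a subtree of the cotree is cut out of the
  part between them; its boundary consists of one cotree edge and of dual tree edges lying on two
  root paths, hence \<open>O(h)\<close> edges in that range of levels.
\<close>

theorem balanced_separator:
  assumes S: "S \<subseteq> V" "30 \<le> card S" and h: "card V \<le> h\<^sup>2"
  shows "\<exists>X\<subseteq>V. card S \<le> 12 * card (X \<inter> S) \<and> 4 * card (X \<inter> S) \<le> 3 * card S \<and> card (cut X) \<le> 30 * h"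
proof -
  have finS: "finite S" using S finite finite_subset by blast
  obtain v0 where v0: "v0 \<in> V" using S by fastforce
  have "0 < card V" using v0 finite by (auto simp: card_gt_0_iff)
  with h have h0: "0 < h" by (cases h) auto
  have "F \<noteq> {}" using card_F by auto
  then obtain rt where "rt \<in> F" by blast
  then obtain d pe p where T: "bfs_tree F E L R rt d pe p"
    using bfs_tree_exists[of rt F E L R] sides connected_F by metis
  interpret T: bfs_tree F E L R rt d pe p by (rule T)
  define E' where "E' = E - pe ` (F - {rt})"
  obtain d' pe' p' where K: "bfs_tree V E' src tgt v0 d' pe' p'" and pe': "pe' ` (V - {v0}) = E'"
    using cotree_exists[OF T v0] unfolding E'_def by blast
  interpret K: bfs_tree V E' src tgt v0 d' pe' p' by (rule K)
  have near: "d f \<le> d (\<phi> v) + 2 \<and> d (\<phi> v) \<le> d f + 2"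
    if "e \<in> E" "v \<in> {src e, tgt e}" "f \<in> {L e, R e}" for e v f
    using local[OF T.lipschitz that] by simp
  \<comment> \<open>The shift by \<open>h\<close> keeps \<open>m - h\<close> below free of
    truncation: thresholds under \<open>h\<close> capture no vertex, so the median \<open>m\<close>
    is at least \<open>h\<close>. The slack 4 in \<open>lev_edge\<close> comes from comparing both
    ends with a common face, at cost 2 each.\<close>
  define lev where "lev v = d (\<phi> v) + h" for v
  have lev_edge: "lev (src e) \<le> lev (tgt e) + 4 \<and> lev (tgt e) \<le> lev (src e) + 4" if "e \<in> E" for e
    using near[OF that, of "src e" "L e"] near[OF that, of "tgt e" "L e"] by (simp add: lev_def)
  let ?A = "\<lambda>r. {v \<in> V. lev v \<le> r}"
  let ?w = "\<lambda>r. card (?A r \<inter> S)"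
  have w_mono: "?w r \<le> ?w r'" if "r \<le> r'" for r r'
    using that finS by (intro card_mono) auto
  define m where "m = (LEAST r. card S \<le> 2 * ?w r)"
  have "\<exists>r. card S \<le> 2 * ?w r"
  proof
    have "?A (Max (lev ` V)) \<inter> S = S" using S finite by auto
    then show "card S \<le> 2 * ?w (Max (lev ` V))" by simp
  qed
  then have m: "card S \<le> 2 * ?w m" unfolding m_def by (rule LeastI_ex)
  have below_m: "2 * ?w r < card S" if "r < m" for r
    using not_less_Least[of r "\<lambda>r. card S \<le> 2 * ?w r"] that unfolding m_def by simp
  have "h \<le> m"
  proof (rule ccontr)
    assume "\<not> h \<le> m"
    then have "?A m \<inter> S = {}" by (auto simp: lev_def)
    with m S show False by simp
  qed
  obtain r0 where r0: "m - h \<le> r0" "r0 < m" "card (cut (?A r0)) \<le> 8 * h"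
    using sparse_level_cut[OF lev_edge h0 h, of "m - h"] \<open>h \<le> m\<close> by auto
  obtain r1 where r1: "m \<le> r1" "r1 < m + h" "card (cut (?A r1)) \<le> 8 * h"
    using sparse_level_cut[OF lev_edge h0 h, of m] by auto
  have w0: "2 * ?w r0 < card S" using below_m r0 by simp
  have w1: "card S \<le> 2 * ?w r1" using m w_mono[OF r1(1)] by simp
  consider "card S \<le> 12 * ?w r0" | "4 * ?w r1 \<le> 3 * card S" 
    | "12 * ?w r0 < card S" "3 * card S < 4 * ?w r1" by linarith
  then show ?thesis
  proof cases
    case 1
    then show ?thesis using w0 r0 by (intro exI[of _ "?A r0"]) auto
  next
    case 2
    then show ?thesis using w1 r1 by (intro exI[of _ "?A r1"]) auto
  next
    case 3
    define M where "M = ?A r1 - ?A r0"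
    define Q where "Q = M \<inter> S"
    have QV: "Q \<subseteq> V" by (auto simp: Q_def M_def)
    have "Q = (?A r1 \<inter> S) - (?A r0 \<inter> S)" by (auto simp: Q_def M_def)
    then have cQ: "card Q = ?w r1 - ?w r0"
      using finS r0 r1 by (simp add: card_Diff_subset subset_iff)
    \<comment> \<open>This is |S|/12 rounded up. Here \<open>Q\<close> has more than 3/4 - 1/12 =
      2/3 of the marks, while 4 \<theta> is about 1/3 of them; the assumption of 30 marks absorbs
      the rounding.\<close>
    define \<theta> where "\<theta> = (card S + 11) div 12"
    have \<theta>: "card S \<le> 12 * \<theta>" "12 * \<theta> \<le> card S + 11" "1 \<le> \<theta>" using S by (auto simp: \<theta>_def)
    have "4 * \<theta> < card Q" using cQ 3 \<theta> S by linarith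
    then obtain v where v: "v \<in> V" "v \<noteq> v0" "\<theta> \<le> card (K.Sub v \<inter> Q)" "card (K.Sub v \<inter> Q) \<le> 4 * \<theta>"
      using balanced_subtree[OF K _ QV] \<theta> by (auto simp: E'_def)
    define X where "X = K.Sub v \<inter> M"
    have XS: "X \<inter> S = K.Sub v \<inter> Q" by (auto simp: X_def Q_def)
    define e0 where "e0 = pe' v"
    have e0: "e0 \<in> E" using K.pe_in[OF v(1,2)] by (auto simp: e0_def E'_def)
    have cut_E': "cut (K.Sub v) - pe ` (F - {rt}) \<subseteq> {e0}"
    proof
      fix e assume e: "e \<in> cut (K.Sub v) - pe ` (F - {rt})"
      then have "e \<in> E'" by (auto simp: E'_def cut_edges_def)
      then obtain u where u: "u \<in> V" "u \<noteq> v0" "e = pe' u" using pe' by auto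
      then have "u = v" using K.tree_edge_cut_Sub[OF v(1,2) u(1,2)] e by (auto simp: cut_edges_def)
      then show "e \<in> {e0}" using u by (simp add: e0_def)
    qed
    \<comment> \<open>These bound the depth of a face at a vertex of \<open>M\<close>: undo the
      shift by \<open>h\<close> and allow 2 for the distance from \<open>\<phi>\<close>.\<close>
    define lo where "lo = r0 - h - 1"
    define hi where "hi = r1 + 2 - h"
    let ?G = "\<lambda>g. {f. g \<in> T.Sub f \<and> lo \<le> d f \<and> d f \<le> hi}"
    have lohi: "lo \<le> hi" "hi - lo \<le> 2 * h + 2" using r0 r1 \<open>h \<le> m\<close> by (auto simp: lo_def hi_def)
    have "cut X \<subseteq> cut (?A r0) \<union> cut (?A r1) \<union> {e0} \<union> pe ` ?G (L e0) \<union> pe ` ?G (R e0)"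
    proof
      fix e assume e: "e \<in> cut X"
      then have eE: "e \<in> E" by (auto simp: cut_edges_def)
      show "e \<in> cut (?A r0) \<union> cut (?A r1) \<union> {e0} \<union> pe ` ?G (L e0) \<union> pe ` ?G (R e0)"
      proof (cases "src e \<in> M \<and> tgt e \<in> M")
        case False
        then have "(src e \<in> M) \<noteq> (tgt e \<in> M)" using e by (auto simp: cut_edges_def X_def)
        then have "e \<in> cut (?A r0) \<union> cut (?A r1)" using eE by (auto simp: cut_edges_def M_def)
        then show ?thesis by blast
      next
        case True
        then have ec: "e \<in> cut (K.Sub v)" using e by (auto simp: cut_edges_def X_def)
        show ?thesis
        proof (cases "e \<in> pe ` (F - {rt})")
          case False
          then show ?thesis using cut_E' ec by blast
        next
          case True
          then obtain f where f: "f \<in> F" "f \<noteq> rt" "e = pe f" by auto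
          have "f \<in> {L e, R e}" using T.sides_pe[OF f(1,2)] f(3) by auto
          then have nf: "d f \<le> d (\<phi> (src e)) + 2" "d (\<phi> (src e)) \<le> d f + 2"
            using near[OF eE, of "src e" f] by auto
          have "r0 < lev (src e)" "lev (src e) \<le> r1"
            using \<open>src e \<in> M \<and> tgt e \<in> M\<close> by (auto simp: M_def)
          then have "lo \<le> d f" "d f \<le> hi" using nf by (auto simp: lo_def hi_def lev_def)
          \<comment> \<open>The edge outside the tree supplied by \<open>cut_tree_edge\<close> can
            only be \<open>e0\<close>, so one side of \<open>e0\<close> lies below
            \<open>f\<close>.\<close>
          moreover have "L e0 \<in> T.Sub f \<or> R e0 \<in> T.Sub f"
            using cut_tree_edge[OF T f(1,2), of "K.Sub v"] ec f(3) cut_E' by blast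
          ultimately show ?thesis using f(3) by blast
        qed
      qed
    qed
    moreover have fG: "finite (?G g)" if "g \<in> F" for g
      using T.card_ancestors(1)[OF that lohi(1)] .
    moreover have cG: "card (pe ` ?G g) \<le> 2 * h + 3" if "g \<in> F" for g
      using T.card_ancestors(2)[OF that lohi(1)] lohi(2) card_image_le[OF fG[OF that], of pe] by linarith
    ultimately have "card (cut X) \<le> card (cut (?A r0) \<union> cut (?A r1) \<union> {e0} \<union> pe ` ?G (L e0) \<union> pe ` ?G (R e0))"
      using finite_cut sides[OF e0] by (intro card_mono) auto
    also have "\<dots> \<le> card (cut (?A r0)) + card (cut (?A r1)) + card {e0}
        + card (pe ` ?G (L e0)) + card (pe ` ?G (R e0))"
      by (intro order.trans[OF card_Un_le] add_mono order.refl)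
    also have "\<dots> \<le> 8 * h + 8 * h + 1 + (2 * h + 3) + (2 * h + 3)"
      using r0(3) r1(3) cG sides[OF e0] by (intro add_mono) auto
    also have "\<dots> \<le> 30 * h" using h0 by simp
    finally have "card (cut X) \<le> 30 * h" .
    moreover have "X \<subseteq> V" by (auto simp: X_def M_def)
    ultimately show ?thesis using v(3,4) \<theta> S XS by (intro exI[of _ X]) auto
  qed
qed

end

section \<open>The plane graph of a meander\<close>

text \<open>The arcs on one side of the line, encoded as a fixed-point-free involution so that an
  arc can be found from either endpoint.\<close>

locale noncrossing_pairing =
  fixes N :: nat and m :: "nat \<Rightarrow> nat"
  assumes N_pos: "0 < N"
    and m_less: "v < N \<Longrightarrow> m v < N"
    and m_m: "v < N \<Longrightarrow> m (m v) = v"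
    and m_neq: "v < N \<Longrightarrow> m v \<noteq> v"
    and no_cross: "\<lbrakk>a < N; b < N; a < b; b < m a\<rbrakk> \<Longrightarrow> \<not> m a < m b"
begin

definition lefts :: "nat set" where "lefts = {a. a < N \<and> a < m a}"

text \<open>A face is numbered 0 if it is the unbounded one, and \<open>Suc a\<close> if it lies directly below the
  arc with left endpoint \<open>a\<close>; its shadow is the set of gaps \<open>{i, i + 1}\<close> that it or a face nested
  in it meets.\<close>

definition faces :: "nat set" where "faces = insert 0 (Suc ` lefts)"

definition shadow :: "nat \<Rightarrow> nat set" where
  "shadow x = (case x of 0 \<Rightarrow> {..<N} | Suc a \<Rightarrow> {a..<m a})"

text \<open>The face bordering the gap from \<open>i\<close> to \<open>i + 1\<close>. The arcs over
  a gap are nested, so the innermost one has the largest left endpoint, which \<open>Max\<close>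
  selects; if there is none, 0 remains.\<close>

definition gap_face :: "nat \<Rightarrow> nat" where
  "gap_face i = Max {x \<in> faces. i \<in> shadow x}"

text \<open>The face on the outer side of the arc starting at \<open>c\<close>: the constraint
  \<open>x \<le> c\<close> excludes \<open>Suc c\<close>, the face on its inner side.\<close>

definition outer_face :: "nat \<Rightarrow> nat" where
  "outer_face c = Max {x \<in> faces. x \<le> c \<and> c \<in> shadow x}"

lemma shadow_simps [simp]: "shadow 0 = {..<N}" "shadow (Suc a) = {a..<m a}"
  by (simp_all add: shadow_def)

lemma finite_lefts [simp]: "finite lefts"
  by (simp add: lefts_def)

lemma finite_faces [simp]: "finite faces"
  by (simp add: faces_def)

lemma zero_in_faces [simp]: "0 \<in> faces"
  by (simp add: faces_def)

lemma Suc_in_faces [simp]: "Suc a \<in> faces \<longleftrightarrow> a \<in> lefts"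
  by (auto simp: faces_def)

lemma shadow_less: "x \<in> faces \<Longrightarrow> i \<in> shadow x \<Longrightarrow> i < N"
  using m_less by (fastforce simp: faces_def lefts_def)

lemma card_lefts: "2 * card lefts = N"
proof -
  let ?R = "{..<N} - lefts"
  have "bij_betw m lefts ?R"
    by (rule bij_betw_byWitness[of _ m])
       (use m_m m_less m_neq in \<open>auto simp: lefts_def not_less order.order_iff_strict\<close>)
  then have "card lefts = card ?R" by (rule bij_betw_same_card)
  moreover have "lefts \<subseteq> {..<N}" by (auto simp: lefts_def)
  ultimately have "card lefts = N - card lefts" "card lefts \<le> N"
    using card_mono[of "{..<N}" lefts] by (simp_all add: card_Diff_subset)
  then show ?thesis by simp
qed

lemma gap_face:
  assumes "i < N"
  shows "gap_face i \<in> faces" "i \<in> shadow (gap_face i)"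
    "\<And>x. x \<in> faces \<Longrightarrow> i \<in> shadow x \<Longrightarrow> x \<le> gap_face i"
proof -
  let ?A = "{x \<in> faces. i \<in> shadow x}"
  have "0 \<in> ?A" using assms by simp
  then have A: "?A \<noteq> {}" "finite ?A" by (blast, simp)
  show "gap_face i \<in> faces" "i \<in> shadow (gap_face i)"
    "\<And>x. x \<in> faces \<Longrightarrow> i \<in> shadow x \<Longrightarrow> x \<le> gap_face i"
    using Max_in[OF A(2,1)] Max_ge[OF A(2)] unfolding gap_face_def[symmetric] by auto
qed

lemma outer_face:
  assumes "c < N"
  shows "outer_face c \<in> faces" "outer_face c \<le> c" "c \<in> shadow (outer_face c)"
    "\<And>x. x \<in> faces \<Longrightarrow> x \<le> c \<Longrightarrow> c \<in> shadow x \<Longrightarrow> x \<le> outer_face c"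
proof -
  let ?A = "{x \<in> faces. x \<le> c \<and> c \<in> shadow x}"
  have "0 \<in> ?A" using assms by simp
  then have A: "?A \<noteq> {}" "finite ?A" by (blast, simp)
  show "outer_face c \<in> faces" "outer_face c \<le> c" "c \<in> shadow (outer_face c)"
    "\<And>x. x \<in> faces \<Longrightarrow> x \<le> c \<Longrightarrow> c \<in> shadow x \<Longrightarrow> x \<le> outer_face c"
    using Max_in[OF A(2,1)] Max_ge[OF A(2)] unfolding outer_face_def[symmetric] by auto
qed

lemma gap_face_eqI:
  assumes "x \<in> faces" "i \<in> shadow x" "\<And>a. a \<in> lefts \<Longrightarrow> i \<in> {a..<m a} \<Longrightarrow> Suc a \<le> x"
  shows "gap_face i = x"
proof -
  have i: "i < N" using shadow_less assms by blast
  have "gap_face i \<le> x"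
    using gap_face(1,2)[OF i] assms(3)[of "gap_face i - 1"] by (cases "gap_face i") auto
  with gap_face(3)[OF i assms(1,2)] show ?thesis by simp
qed

text \<open>The gap \<open>N - 1\<close> is the part of the line through infinity; every arc has
  ended at \<open>N - 1\<close>, so none covers it.\<close>

lemma gap_face_last: "gap_face (N - 1) = 0"
  by (rule gap_face_eqI) (use N_pos m_less in \<open>fastforce simp: lefts_def\<close>)+

lemma gap_faces_left:
  assumes v: "v \<in> lefts"
  shows "gap_face v = Suc v" "gap_face (if v = 0 then N - 1 else v - 1) = outer_face v"
proof -
  show "gap_face v = Suc v"
    using v by (intro gap_face_eqI) (auto simp: lefts_def)
  show "gap_face (if v = 0 then N - 1 else v - 1) = outer_face v"
  proof (cases "v = 0")
    case True
    then show ?thesis using gap_face_last outer_face(2)[of v] v by (auto simp: lefts_def)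
  next
    case False
    have "x \<in> faces \<Longrightarrow> v - 1 \<in> shadow x \<longleftrightarrow> x \<le> v \<and> v \<in> shadow x" for x
    proof (cases x)
      case (Suc a)
      assume "x \<in> faces"
      then have "a \<in> lefts" using Suc by simp
      then have "m a \<noteq> v" using m_m[of a] v by (auto simp: lefts_def)
      then show ?thesis using False Suc by auto
    qed (use v in \<open>auto simp: lefts_def\<close>)
    then have "{x \<in> faces. v - 1 \<in> shadow x} = {x \<in> faces. x \<le> v \<and> v \<in> shadow x}" by blast
    then show ?thesis using False by (simp add: gap_face_def outer_face_def)
  qed
qed

text \<open>At a right endpoint the roles of the two gaps are exchanged: the preceding gap lies
  under the arc. Non-crossing ensures that no arc starting inside this one still covers that
  gap.\<close>

lemma gap_faces_right:
  assumes v: "v < N" "v \<notin> lefts"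
  shows "m v \<in> lefts" "v \<noteq> 0" "gap_face (v - 1) = Suc (m v)" "gap_face v = outer_face (m v)"
proof -
  let ?a = "m v"
  have a: "?a < v" using v m_neq[OF v(1)] by (auto simp: lefts_def)
  have ma: "m ?a = v" using m_m v by simp
  show al: "?a \<in> lefts" using a ma v by (auto simp: lefts_def)
  show "v \<noteq> 0" using a by auto
  show "gap_face (v - 1) = Suc ?a"
  proof (rule gap_face_eqI)
    fix b assume b: "b \<in> lefts" "v - 1 \<in> {b..<m b}"
    have "?a < b \<Longrightarrow> m b \<noteq> v" using b ma m_m[of b] by (auto simp: lefts_def)
    moreover have "b < N" "b \<le> v - 1" "v - 1 < m b" using b by (auto simp: lefts_def)
    ultimately show "Suc b \<le> Suc ?a"
      using no_cross[of ?a b] a ma v(1) by (cases "?a < b") linarith+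
  qed (use al a ma in auto)
  have "x \<in> faces \<Longrightarrow> v \<in> shadow x \<longleftrightarrow> x \<le> ?a \<and> ?a \<in> shadow x" for x
  proof (cases x)
    case (Suc b)
    assume "x \<in> faces"
    then have b: "b \<in> lefts" "b < N" using Suc by (auto simp: lefts_def)
    have "m b \<noteq> v" if "b \<noteq> ?a" using that b m_m[of b] by auto
    moreover have "b \<noteq> v" using b v by auto
    ultimately have "b \<le> v \<and> v < m b \<longleftrightarrow> b < ?a \<and> ?a < m b"
      using no_cross[of ?a b] no_cross[of b ?a] a ma b v
      by (cases b ?a rule: linorder_cases) auto
    then show ?thesis using Suc by auto
  qed (use v a in auto)
  then have "{x \<in> faces. v \<in> shadow x} = {x \<in> faces. x \<le> ?a \<and> ?a \<in> shadow x}" by blast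
  then show "gap_face v = outer_face ?a" by (simp add: gap_face_def outer_face_def)
qed

text \<open>A gap in the shadow either borders the face itself or lies under an arc whose outer side
  is this face. These pieces turn out to be disjoint, which makes the boundary sum of a face
  computable.\<close>

lemma shadow_decomp:
  assumes x: "x \<in> faces"
  shows "shadow x = {i \<in> {..<N}. gap_face i = x} \<union> (\<Union>c\<in>{c \<in> lefts. outer_face c = x}. {c..<m c})"
    (is "_ = ?O \<union> ?U")
proof
  show "?O \<union> ?U \<subseteq> shadow x"
  proof
    fix i assume "i \<in> ?O \<union> ?U"
    then consider "i < N" "gap_face i = x" | c where "c \<in> lefts" "outer_face c = x" "i \<in> {c..<m c}"
      by auto
    then show "i \<in> shadow x"
    proof cases
      case 1 then show ?thesis using gap_face(2) by auto
    next
      case 2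
      have c: "c < N" "m c < N" using 2 m_less by (auto simp: lefts_def)
      note o = outer_face(2,3)[OF c(1)]
      show ?thesis
      proof (cases x)
        case 0 then show ?thesis using 2 c by auto
      next
        case (Suc a)
        then have "a \<in> lefts" using x by simp
        then show ?thesis using no_cross[of a c] 2 c o Suc by (auto simp: lefts_def)
      qed
    qed
  qed
  show "shadow x \<subseteq> ?O \<union> ?U"
  proof
    fix i assume i: "i \<in> shadow x"
    then have iN: "i < N" using shadow_less x by blast
    show "i \<in> ?O \<union> ?U"
    proof (cases "gap_face i = x")
      case False
      \<comment> \<open>The least such \<open>c\<close> gives the outermost arc strictly inside
        \<open>x\<close> over gap \<open>i\<close>. Its outer face is \<open>x\<close>, since an arc
        in between would start earlier.\<close>
      let ?P = "\<lambda>c. c \<in> lefts \<and> i \<in> {c..<m c} \<and> x < Suc c"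
      have "x < gap_face i" using gap_face(3)[OF iN x i] False by simp
      then have "?P (gap_face i - 1)" using gap_face(1,2)[OF iN] by (cases "gap_face i") auto
      then have "?P (LEAST c. ?P c)" by (rule LeastI)
      then obtain c where c: "?P c" and least: "\<And>b. ?P b \<Longrightarrow> c \<le> b"
        by (metis (mono_tags, lifting) Least_le)
      have cN: "c < N" using c by (auto simp: lefts_def)
      have "c \<in> shadow x"
        using i c cN by (cases x) auto
      then have "x \<le> outer_face c" using outer_face(4)[OF cN x] c by simp
      moreover have "\<not> x < outer_face c"
      proof
        assume lt: "x < outer_face c"
        then obtain b where b: "outer_face c = Suc b" by (cases "outer_face c") auto
        note o = outer_face(1-3)[OF cN]
        have bl: "b \<in> lefts" "b < c" "c < m b" "b < N" using o b by (auto simp: lefts_def)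
        then have "\<not> m b < m c" using no_cross[of b c] cN by simp
        then have "?P b" using bl lt b c by auto
        then show False using least[of b] bl by simp
      qed
      ultimately have "outer_face c = x" by simp
      then show ?thesis using c by auto
    qed (use iN in auto)
  qed
qed

lemma disjoint_siblings:
  assumes "c \<in> lefts" "c' \<in> lefts" "outer_face c = outer_face c'" "c < c'"
  shows "{c..<m c} \<inter> {c'..<m c'} = {}"
proof (rule ccontr)
  assume "\<not> ?thesis"
  then have "c' < m c" using assms by auto
  then have "Suc c \<le> outer_face c'"
    using outer_face(4)[of c' "Suc c"] assms by (auto simp: lefts_def)
  moreover have "outer_face c \<le> c" using outer_face(2)[of c] assms by (auto simp: lefts_def)
  ultimately show False using assms by simp
qed

lemma disjoint_gap_face:
  assumes "c \<in> lefts" "i < N" "gap_face i = outer_face c"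
  shows "i \<notin> {c..<m c}"
proof
  assume "i \<in> {c..<m c}"
  then have "Suc c \<le> gap_face i" using gap_face(3)[of i "Suc c"] assms by auto
  moreover have "outer_face c \<le> c" using outer_face(2)[of c] assms by (auto simp: lefts_def)
  ultimately show False using assms by simp
qed

text \<open>Telescoping along the shadow of the face gives the difference over its bounding arc, or
  0 around the closed line. By \<open>shadow_decomp\<close>, each stretch of line under a nested arc
  may be replaced by that arc.\<close>

lemma facial_telescope:
  fixes y :: "nat \<Rightarrow> int"
  assumes x: "x \<in> faces"
  shows "(\<Sum>i<N. (y (Suc i mod N) - y i) * of_bool (gap_face i = x))
       + (\<Sum>c\<in>lefts. (y (m c) - y c) * of_bool (outer_face c = x))
       = (\<Sum>c\<in>lefts. (y (m c) - y c) * of_bool (Suc c = x))"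
proof -
  let ?d = "\<lambda>i. y (Suc i mod N) - y i"
  have arc: "(\<Sum>i\<in>{c..<m c}. ?d i) = y (m c) - y c" if "c \<in> lefts" for c
  proof -
    have c: "c < m c" "m c < N" using that m_less by (auto simp: lefts_def)
    then have "(\<Sum>i\<in>{c..<m c}. ?d i) = (\<Sum>i\<in>{c..<m c}. y (Suc i) - y i)" by (intro sum.cong) auto
    also have "\<dots> = y (m c) - y c" using c by (simp add: sum_Suc_diff')
    finally show ?thesis .
  qed
  let ?O = "{i \<in> {..<N}. gap_face i = x}" and ?C = "{c \<in> lefts. outer_face c = x}"
  have "(\<Sum>i\<in>shadow x. ?d i) = sum ?d ?O + sum ?d (\<Union>c\<in>?C. {c..<m c})"
    unfolding shadow_decomp[OF x]
    by (rule sum.union_disjoint) (use disjoint_gap_face in auto)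
  also have "sum ?d (\<Union>c\<in>?C. {c..<m c}) = (\<Sum>c\<in>?C. \<Sum>i\<in>{c..<m c}. ?d i)"
  proof (rule sum.UNION_disjoint)
    show "\<forall>c\<in>?C. \<forall>c'\<in>?C. c \<noteq> c' \<longrightarrow> {c..<m c} \<inter> {c'..<m c'} = {}"
    proof (intro ballI impI)
      fix c c' assume "c \<in> ?C" "c' \<in> ?C" "c \<noteq> c'"
      then show "{c..<m c} \<inter> {c'..<m c'} = {}"
        using disjoint_siblings[of c c'] disjoint_siblings[of c' c]
        by (cases c c' rule: linorder_cases) (simp_all add: Int_commute)
    qed
  qed simp_all
  also have "\<dots> = (\<Sum>c\<in>?C. y (m c) - y c)" by (intro sum.cong) (use arc in auto)
  also have "\<dots> = (\<Sum>c\<in>lefts. (y (m c) - y c) * of_bool (outer_face c = x))"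
    by (intro sum.mono_neutral_cong_left) auto
  also have "sum ?d ?O = (\<Sum>i<N. ?d i * of_bool (gap_face i = x))"
    by (intro sum.mono_neutral_cong_left) auto
  also have "(\<Sum>i\<in>shadow x. ?d i) = (\<Sum>c\<in>lefts. (y (m c) - y c) * of_bool (Suc c = x))"
  proof (cases x)
    case 0
    obtain K where K: "N = Suc K" using N_pos by (cases N) auto
    have "(\<Sum>i<N. ?d i) = (\<Sum>i<K. y (Suc i) - y i) + (y 0 - y K)"
      unfolding K sum.lessThan_Suc by (intro arg_cong2[of _ _ _ _ "(+)"] sum.cong) auto
    also have "\<dots> = 0" by (simp add: sum_lessThan_telescope)
    finally show ?thesis using 0 by simp
  next
    case (Suc a)
    then have "a \<in> lefts" using x by simp
    then show ?thesis using Suc arc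
      by (simp add: of_bool_def if_distrib[of "\<lambda>t. _ * t"] sum.delta' cong: if_cong)
  qed
  finally show ?thesis by simp
qed

end

section \<open>Gluing the two sides along the closed line\<close>

datatype meander_edge = Line nat | Arc bool nat

locale meander_system =
  fixes N :: nat and m :: "bool \<Rightarrow> nat \<Rightarrow> nat"
  assumes pairing: "noncrossing_pairing N (m s)"
begin

sublocale P: noncrossing_pairing N "m s" for s
  by (rule pairing)

definition edges :: "meander_edge set" where
  "edges = Line ` {..<N} \<union> (\<Union>s. Arc s ` P.lefts s)"

definition faces :: "(bool \<times> nat) set" where
  "faces = (\<Union>s. Pair s ` P.faces s)"

text \<open>
  \<open>True\<close> stands for the side above the line. The line is closed up through infinity by \<open>Line (N - 1)\<close>;
  it runs from left to right and arcs run from their left to their right endpoint, which is why the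
  two faces of an arc are exchanged on the lower side.
\<close>

fun src :: "meander_edge \<Rightarrow> nat" where
  "src (Line i) = i" | "src (Arc s a) = a"

fun tgt :: "meander_edge \<Rightarrow> nat" where
  "tgt (Line i) = Suc i mod N" | "tgt (Arc s a) = m s a"

fun left_face :: "meander_edge \<Rightarrow> bool \<times> nat" where
  "left_face (Line i) = (True, P.gap_face True i)"
| "left_face (Arc s a) = (s, if s then P.outer_face s a else Suc a)"

fun right_face :: "meander_edge \<Rightarrow> bool \<times> nat" where
  "right_face (Line i) = (False, P.gap_face False i)"
| "right_face (Arc s a) = (s, if s then Suc a else P.outer_face s a)"

lemma N_pos: "0 < N"
  by (rule P.N_pos)

lemma edges_UNIV: "edges = Line ` {..<N} \<union> (Arc True ` P.lefts True \<union> Arc False ` P.lefts False)"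
  by (auto simp: edges_def UNIV_bool)

lemma faces_UNIV: "faces = Pair True ` P.faces True \<union> Pair False ` P.faces False"
  by (auto simp: faces_def UNIV_bool)

lemma in_faces [simp]: "(s, x) \<in> faces \<longleftrightarrow> x \<in> P.faces s"
  by (auto simp: faces_def)

lemma sum_edges:
  fixes t :: "meander_edge \<Rightarrow> 'a :: comm_monoid_add"
  shows "sum t edges = (\<Sum>i<N. t (Line i))
    + ((\<Sum>a\<in>P.lefts True. t (Arc True a)) + (\<Sum>a\<in>P.lefts False. t (Arc False a)))"
  unfolding edges_UNIV
  by (subst sum.union_disjoint | subst sum.reindex | auto simp: inj_on_def)+

lemma left_less: "a \<in> P.lefts s \<Longrightarrow> a < N"
  by (simp add: P.lefts_def)

definition prev :: "nat \<Rightarrow> nat" where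
  "prev v = (if v = 0 then N - 1 else v - 1)"

definition arc_at :: "bool \<Rightarrow> nat \<Rightarrow> meander_edge" where
  "arc_at s v = Arc s (if v \<in> P.lefts s then v else m s v)"

text \<open>Near \<open>v\<close> the arc on side \<open>s\<close> separates the two gaps adjacent
  to \<open>v\<close>, whichever of its endpoints \<open>v\<close> is.\<close>

lemma arc_at:
  assumes "v < N"
  shows "arc_at s v \<in> edges"
    "{left_face (arc_at s v), right_face (arc_at s v)}
      = {(s, P.gap_face s (prev v)), (s, P.gap_face s v)}"
  using P.gap_faces_left[of v s] P.gap_faces_right[of v s] assms
  by (cases "v \<in> P.lefts s"; cases s; auto simp: arc_at_def edges_def prev_def)+

lemma edges_at:
  assumes "v < N" "e \<in> edges" "v \<in> {src e, tgt e}"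
  shows "e \<in> {Line v, Line (prev v), arc_at True v, arc_at False v}"
proof (cases e)
  case (Line i)
  then have "i < N" using assms by (auto simp: edges_def)
  then have "i = prev v" if "v = Suc i mod N"
    using that by (cases "Suc i = N") (auto simp: prev_def)
  then show ?thesis using Line assms by auto
next
  case (Arc s a)
  then have a: "a \<in> P.lefts s" using assms by (auto simp: edges_def)
  have "arc_at s v = e"
  proof (cases "v = a")
    case True
    then show ?thesis using a Arc by (simp add: arc_at_def)
  next
    case False
    then have v: "v = m s a" using Arc assms by auto
    have "m s v = a" using v P.m_m[of a s] a by (simp add: P.lefts_def)
    moreover have "v \<notin> P.lefts s" using v a \<open>m s v = a\<close> by (auto simp: P.lefts_def)
    ultimately show ?thesis using Arc by (simp add: arc_at_def)
  qed
  then show ?thesis by (cases s) auto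
qed

lemma plane_graph: "plane_graph {..<N} faces edges src tgt left_face right_face (\<lambda>v. (True, P.gap_face True v))"
proof
  show "finite edges" "finite faces" by (auto simp: edges_UNIV faces_UNIV)
  show "src e \<in> {..<N} \<and> tgt e \<in> {..<N}" if "e \<in> edges" for e
    using that N_pos P.m_less by (auto simp: edges_def P.lefts_def)
  show "left_face e \<in> faces \<and> right_face e \<in> faces" if "e \<in> edges" for e
    using that P.gap_face(1) P.outer_face(1)[OF left_less] by (auto simp: edges_def)
  show "card edges = 2 * card {..<N}"
    unfolding card_eq_sum sum_edges using P.card_lefts[of True] P.card_lefts[of False] by simp
  \<comment> \<open>Each side has N/2 arcs and so N/2 + 1 faces. The line through infinity separates
    the two unbounded faces, so both are counted.\<close>
  have "card (P.faces s) = Suc (card (P.lefts s))" for s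
    unfolding P.faces_def by (subst card_insert_disjoint) (auto simp: card_image)
  then show "card faces = card {..<N} + 2"
    unfolding faces_UNIV using P.card_lefts[of True] P.card_lefts[of False]
    by (subst card_Un_disjoint) (auto simp: card_image inj_on_def)
next
  fix f and y :: "nat \<Rightarrow> int"
  assume "f \<in> faces"
  then obtain s x where f: "f = (s, x)" "x \<in> P.faces s" by (auto simp: faces_def)
  have "(\<Sum>i<N. (y (Suc i mod N) - y i) * of_bool (P.gap_face s i = x))
       + (\<Sum>c\<in>P.lefts s. (y (m s c) - y c) * of_bool (P.outer_face s c = x))
       = (\<Sum>c\<in>P.lefts s. (y (m s c) - y c) * of_bool (Suc c = x))"
    by (rule P.facial_telescope[OF f(2)])
  then show "(\<Sum>e\<in>edges. (y (tgt e) - y (src e)) * (of_bool (left_face e = f) - of_bool (right_face e = f))) = 0"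
    unfolding sum_edges f(1) by (cases s) (auto simp: right_diff_distrib sum_subtractf sum_negf)
next
  fix X assume X: "X \<subseteq> {..<N}" "X \<noteq> {}" "cut_edges src tgt edges X = {}"
  have step: "i \<in> X \<longleftrightarrow> Suc i \<in> X" if "Suc i < N" for i
  proof -
    have "Line i \<in> edges" using that by (auto simp: edges_def)
    with X(3) have "src (Line i) \<in> X \<longleftrightarrow> tgt (Line i) \<in> X" unfolding cut_edges_def by blast
    then show ?thesis using that by simp
  qed
  have *: "i \<in> X \<longleftrightarrow> 0 \<in> X" if "i < N" for i
    using that by (induction i) (use step in auto)
  show "X = {..<N}" using X(1,2) * by blast
next
  fix Z assume Z: "Z \<subseteq> faces" "Z \<noteq> {}" "cut_edges left_face right_face edges Z = {}"
  have same: "left_face e \<in> Z \<longleftrightarrow> right_face e \<in> Z" if "e \<in> edges" for e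
    using Z(3) that by (auto simp: cut_edges_def)
  \<comment> \<open>Crossing an arc outwards leads to a face with a smaller number, so every face is
    joined to the unbounded face of its side.\<close>
  have up: "x \<in> P.faces s \<Longrightarrow> (s, x) \<in> Z \<longleftrightarrow> (s, 0) \<in> Z" for s x
  proof (induction x rule: less_induct)
    case (less x)
    show ?case
    proof (cases x)
      case (Suc a)
      then have a: "a \<in> P.lefts s" using less.prems by simp
      then have "Arc s a \<in> edges" by (auto simp: edges_def)
      from same[OF this] have "(s, Suc a) \<in> Z \<longleftrightarrow> (s, P.outer_face s a) \<in> Z" by (cases s) auto
      moreover have "(s, P.outer_face s a) \<in> Z \<longleftrightarrow> (s, 0) \<in> Z"
        using P.outer_face(1,2)[OF left_less[OF a]] Suc by (intro less.IH) (auto simp: le_imp_less_Suc)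
      ultimately show ?thesis using Suc by simp
    qed simp
  qed
  have "Line (N - 1) \<in> edges" using N_pos by (auto simp: edges_def)
  from same[OF this] have "(True, 0) \<in> Z \<longleftrightarrow> (False, 0) \<in> Z" by (simp add: P.gap_face_last[simplified])
  then have "(s, x) \<in> Z \<longleftrightarrow> (True, 0) \<in> Z" if "x \<in> P.faces s" for s x
    using up[OF that] by (cases s) auto
  then show "Z = faces" using Z(1,2) unfolding faces_def by blast
next
  fix v assume "v \<in> {..<N}"
  then have "{e \<in> edges. src e = v \<or> tgt e = v} \<subseteq> {Line v, Line (prev v), arc_at True v, arc_at False v}"
    using edges_at[of v] by blast
  then have "card {e \<in> edges. src e = v \<or> tgt e = v} \<le> card {Line v, Line (prev v), arc_at True v, arc_at False v}"
    by (rule card_mono[rotated]) simp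
  also have "\<dots> \<le> 4" by (simp add: card_insert_if)
  finally show "card {e \<in> edges. src e = v \<or> tgt e = v} \<le> 4" .
next
  fix d :: "bool \<times> nat \<Rightarrow> nat" and e v f
  assume lip: "\<And>e. e \<in> edges \<Longrightarrow>
      d (left_face e) \<le> Suc (d (right_face e)) \<and> d (right_face e) \<le> Suc (d (left_face e))"
    and e: "e \<in> edges" "v \<in> {src e, tgt e}" and f: "f \<in> {left_face e, right_face e}"
  have vN: "v < N" using e N_pos P.m_less by (auto simp: edges_def P.lefts_def)
  have pN: "prev v < N" using vN by (auto simp: prev_def)
  \<comment> \<open>Around \<open>v\<close> lie the four faces \<open>?a s\<close> and
    \<open>?b s\<close>. From the reference face \<open>?b True\<close>, the faces
    \<open>?a True\<close> and \<open>?b False\<close> are one crossing away, and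
    \<open>?a False\<close> is two.\<close>
  let ?a = "\<lambda>s. (s, P.gap_face s (prev v))" and ?b = "\<lambda>s. (s, P.gap_face s v)"
  have arc: "d (?a s) \<le> Suc (d (?b s)) \<and> d (?b s) \<le> Suc (d (?a s))" for s
    using lip[OF arc_at(1)[OF vN, of s]] arc_at(2)[OF vN, of s] unfolding doubleton_eq_iff by metis
  have line: "d (?b True) \<le> Suc (d (?b False)) \<and> d (?b False) \<le> Suc (d (?b True))"
    using lip[of "Line v"] vN by (auto simp: edges_def)
  have "f \<in> {?a True, ?a False, ?b True, ?b False}"
    using edges_at[OF vN e(1) e(2)] f arc_at(2)[OF vN] by (auto simp: doubleton_eq_iff)
  then show "d f \<le> d (True, P.gap_face True v) + 2 \<and> d (True, P.gap_face True v) \<le> d f + 2"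
    using arc[of True] arc[of False] line by auto
qed simp

end

section \<open>Counting orderings with few switches\<close>

fun switches :: "bool list \<Rightarrow> nat" where
  "switches (a # b # bs) = of_bool (a \<noteq> b) + switches (b # bs)"
| "switches _ = 0"

lemma switches_Cons_le: "switches bs \<le> switches (b # bs)" "switches (a # bs) \<le> switches (a # b # bs)"
  by (cases bs; auto)+

lemma switches_conv_card: "switches bs = card {i. Suc i < length bs \<and> bs ! i \<noteq> bs ! Suc i}"
proof (induction bs rule: switches.induct)
  case (1 a b bs)
  let ?A = "{i. Suc i < length (b # bs) \<and> (b # bs) ! i \<noteq> (b # bs) ! Suc i}"
  have "{i. Suc i < length (a # b # bs) \<and> (a # b # bs) ! i \<noteq> (a # b # bs) ! Suc i}
      = (if a \<noteq> b then {0} else {}) \<union> Suc ` ?A"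
  proof (rule set_eqI)
    fix i
    show "i \<in> {i. Suc i < length (a # b # bs) \<and> (a # b # bs) ! i \<noteq> (a # b # bs) ! Suc i} \<longleftrightarrow>
      i \<in> (if a \<noteq> b then {0} else {}) \<union> Suc ` ?A"
      by (cases i) auto
  qed
  moreover have "finite ?A" by (rule finite_subset[of _ "{..<length (b # bs)}"]) auto
  ultimately show ?case using 1 by (simp add: card_image)
qed auto

lemma switches_filter_le: "switches (map P (filter Q xs)) \<le> switches (map P xs)"
proof -
  \<comment> \<open>The fixed letter in front carries the induction: after deletions, the next
    surviving letter may follow a distant one.\<close>
  have *: "switches (a # map P (filter Q xs)) \<le> switches (a # map P xs)" for a xs
  proof (induction xs arbitrary: a)
    case (Cons y ys)
    show ?case
      using Cons.IH[of "P y"] order.trans[OF Cons.IH[of a] switches_Cons_le(2)[of a "map P ys" "P y"]] by auto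
  qed auto
  show ?thesis
  proof (induction xs)
    case (Cons y ys)
    then show ?case
      using *[of "P y" ys] switches_Cons_le(1)[of "map P ys" "P y"] by (cases "Q y") auto
  qed auto
qed

text \<open>The first letter is free and each later one contributes 1 for staying or x for
  switching, so the sum is 2 (1 + x)^(n - 1) for positive n.\<close>

lemma sum_power_switches:
  fixes x :: real
  assumes "0 \<le> x"
  shows "(\<Sum>bs | length bs = n. x ^ switches bs) \<le> 2 * (1 + x) ^ n"
proof (cases n)
  case (Suc m)
  have "(\<Sum>bs | length bs = Suc m \<and> hd bs = b. x ^ switches bs) = (1 + x) ^ m" for b
  proof (induction m arbitrary: b)
    case 0
    have "{bs. length bs = Suc 0 \<and> hd bs = b} = {[b]}" by (auto simp: length_Suc_conv)
    then show ?case by simp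
  next
    case (Suc m)
    let ?B = "\<lambda>m b. {bs :: bool list. length bs = Suc m \<and> hd bs = b}"
    have fin: "finite (?B m b)" for m b
      by (rule finite_subset[OF _ finite_lists_length_eq[of UNIV "Suc m"]]) auto
    have "?B (Suc m) b = (#) b ` (?B m b \<union> ?B m (\<not> b))"
      by (auto simp: length_Suc_conv image_iff)
    then have "(\<Sum>bs\<in>?B (Suc m) b. x ^ switches bs) = (\<Sum>bs\<in>?B m b \<union> ?B m (\<not> b). x ^ switches (b # bs))"
      by (simp add: sum.reindex)
    also have "\<dots> = (\<Sum>bs\<in>?B m b. x ^ switches (b # bs)) + (\<Sum>bs\<in>?B m (\<not> b). x ^ switches (b # bs))"
      using fin by (intro sum.union_disjoint) auto
    also have "\<dots> = (\<Sum>bs\<in>?B m b. x ^ switches bs) + (\<Sum>bs\<in>?B m (\<not> b). x * x ^ switches bs)"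
      by (intro arg_cong2[of _ _ _ _ "(+)"] sum.cong) (auto simp: length_Suc_conv)
    also have "\<dots> = (1 + x) ^ Suc m"
      using Suc by (simp add: sum_distrib_left[symmetric] algebra_simps)
    finally show ?case .
  qed
  note half = this
  have fin: "finite {bs :: bool list. length bs = Suc m}"
    using finite_lists_length_eq[of "UNIV :: bool set" "Suc m"] by simp
  have "{bs :: bool list. length bs = n} = {bs. length bs = Suc m \<and> hd bs = True} \<union> {bs. length bs = Suc m \<and> hd bs = False}"
    using Suc by auto
  then have "(\<Sum>bs | length bs = n. x ^ switches bs) = (1 + x) ^ m + (1 + x) ^ m"
    using fin by (subst half[of True, symmetric], subst half[of False, symmetric])
      (auto intro!: sum.union_disjoint)
  also have "\<dots> \<le> 2 * (1 + x) ^ n"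
    using power_increasing[of m n "1 + x"] assms Suc by simp
  finally show ?thesis .
qed auto

definition few_switches :: "nat \<Rightarrow> nat \<Rightarrow> bool list set" where
  "few_switches n k = {bs. length bs = n \<and> switches bs \<le> k}"

lemma finite_few_switches: "finite (few_switches n k)"
  by (rule finite_subset[OF _ finite_lists_length_eq[of UNIV n]]) (auto simp: few_switches_def)

text \<open>A Chernoff bound: each word counted has weight at least x^k in the generating
  function.\<close>

lemma card_few_switches:
  fixes x :: real
  assumes "0 < x" "x \<le> 1"
  shows "real (card (few_switches n k)) \<le> 2 * (1 + x) ^ n / x ^ k"
proof -
  have "real (card (few_switches n k)) * x ^ k = (\<Sum>bs\<in>few_switches n k. x ^ k)" by simp
  also have "\<dots> \<le> (\<Sum>bs\<in>few_switches n k. x ^ switches bs)"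
    using assms by (intro sum_mono power_decreasing) (auto simp: few_switches_def)
  also have "\<dots> \<le> (\<Sum>bs | length bs = n. x ^ switches bs)"
    using finite_lists_length_eq[of "UNIV :: bool set" n] assms
    by (intro sum_mono2) (auto simp: few_switches_def)
  also have "\<dots> \<le> 2 * (1 + x) ^ n" using assms by (intro sum_power_switches) auto
  finally show ?thesis using assms by (simp add: pos_le_divide_eq)
qed

lemma list_eq_if_filters_eq:
  assumes "map P xs = map P ys" "filter P xs = filter P ys" "filter (\<lambda>x. \<not> P x) xs = filter (\<lambda>x. \<not> P x) ys"
  shows "xs = ys"
proof -
  have "length xs = length ys" using assms(1) map_eq_imp_length_eq by blast
  then show ?thesis using assms by (induction xs ys rule: list_induct2) (auto split: if_splits)
qed

text \<open>Given the pattern, an ordering is determined by the orders it induces on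
  \<open>A\<close> and on the complement.\<close>

lemma card_permutations_with_pattern:
  assumes A: "A \<subseteq> {..<n}"
  shows "card {xs \<in> permutations_of_set {..<n}. map (\<lambda>i. i \<in> A) xs = bs} \<le> fact (card A) * fact (n - card A)"
    (is "card ?P \<le> _")
proof -
  have finA: "finite A" using A finite_subset by blast
  let ?f = "\<lambda>xs. (filter (\<lambda>i. i \<in> A) xs, filter (\<lambda>i. i \<notin> A) xs)"
  have "card ?P \<le> card (permutations_of_set A \<times> permutations_of_set ({..<n} - A))"
  proof (rule card_inj_on_le)
    show "inj_on ?f ?P" by (rule inj_onI) (auto intro!: list_eq_if_filters_eq[of "\<lambda>i. i \<in> A"])
    show "?f ` ?P \<subseteq> permutations_of_set A \<times> permutations_of_set ({..<n} - A)"
      using A by (auto simp: permutations_of_set_def)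
  qed (use finA in auto)
  also have "\<dots> = fact (card A) * fact (n - card A)"
    using finA A by (simp add: card_cartesian_product card_Diff_subset)
  finally show ?thesis .
qed

text \<open>The binomial coefficient is at least (n/a)^a. The upper bound on \<open>a\<close> makes
  the base at least 4/3, the lower bound makes the exponent at least n/12.\<close>

lemma fact_mult_fact_le:
  assumes "n \<le> 12 * a" "4 * a \<le> 3 * n"
  shows "fact a * fact (n - a) \<le> fact n * (3 / 4 :: real) powr (n / 12)"
proof (cases "a = 0")
  case True
  then show ?thesis using assms by simp
next
  case False
  have an: "a \<le> n" using assms by simp
  have "(4 / 3 :: real) powr (n / 12) \<le> (4 / 3) powr a" using assms by (intro powr_mono) auto
  also have "\<dots> = (4 / 3) ^ a" by (simp add: powr_realpow)
  also have "\<dots> \<le> (real n / real a) ^ a"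
    using assms False by (intro power_mono) (auto simp: field_simps)
  also have "\<dots> \<le> real (n choose a)" by (rule binomial_ge_n_over_k_pow_k[OF an])
  also have "\<dots> = fact n / (fact a * fact (n - a))" by (rule binomial_fact[OF an])
  finally have "(4 / 3 :: real) powr (n / 12) * (fact a * fact (n - a)) \<le> fact n"
    by (simp add: field_simps)
  moreover have "(4 / 3 :: real) powr (n / 12) * (3 / 4) powr (n / 12) = 1"
    by (simp flip: powr_mult)
  ultimately show ?thesis
    using mult_right_mono[of "(4 / 3 :: real) powr (n / 12) * (fact a * fact (n - a))" "fact n" "(3 / 4) powr (n / 12)"]
    by (simp add: mult_ac)
qed

definition separable :: "nat \<Rightarrow> nat \<Rightarrow> nat list \<Rightarrow> bool" where
  "separable n k xs \<longleftrightarrow> (\<exists>A\<subseteq>{..<n}. n \<le> 12 * card A \<and> 4 * card A \<le> 3 * n \<and>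
     switches (map (\<lambda>i. i \<in> A) [0..<n]) \<le> k \<and> switches (map (\<lambda>i. i \<in> A) xs) \<le> k)"

text \<open>The square arises because \<open>A\<close> and its pattern along \<open>xs\<close> are
  each encoded by a word with at most \<open>k\<close> switches.\<close>

lemma card_separable:
  "real (card {xs \<in> permutations_of_set {..<n}. separable n k xs})
    \<le> (real (card (few_switches n k)))\<^sup>2 * (fact n * (3 / 4) powr (n / 12))"
proof -
  let ?B = "few_switches n k"
  define \<A> where "\<A> = {A. A \<subseteq> {..<n} \<and> n \<le> 12 * card A \<and> 4 * card A \<le> 3 * n \<and>
     switches (map (\<lambda>i. i \<in> A) [0..<n]) \<le> k}"
  let ?P = "\<lambda>A bs. {xs \<in> permutations_of_set {..<n}. map (\<lambda>i. i \<in> A) xs = bs}"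
  let ?M = "fact n * (3 / 4 :: real) powr (n / 12)"
  have fin\<A>: "finite \<A>" by (rule finite_subset[of _ "Pow {..<n}"]) (auto simp: \<A>_def)
  have "card \<A> \<le> card ?B"
  proof (rule card_inj_on_le)
    show "inj_on (\<lambda>A. map (\<lambda>i. i \<in> A) [0..<n]) \<A>"
      by (rule inj_onI) (auto simp: \<A>_def)
  qed (auto simp: \<A>_def few_switches_def finite_few_switches[unfolded few_switches_def])
  then have c\<A>: "real (card \<A>) \<le> real (card ?B)" by simp
  have "{xs \<in> permutations_of_set {..<n}. separable n k xs} \<subseteq> (\<Union>(A, bs)\<in>\<A> \<times> ?B. ?P A bs)"
  proof
    fix xs assume "xs \<in> {xs \<in> permutations_of_set {..<n}. separable n k xs}"
    then obtain A where "A \<in> \<A>" "switches (map (\<lambda>i. i \<in> A) xs) \<le> k" "xs \<in> permutations_of_set {..<n}"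
      by (auto simp: separable_def \<A>_def)
    then show "xs \<in> (\<Union>(A, bs)\<in>\<A> \<times> ?B. ?P A bs)"
      by (intro UN_I[of "(A, map (\<lambda>i. i \<in> A) xs)"])
         (auto simp: few_switches_def length_finite_permutations_of_set)
  qed
  then have "card {xs \<in> permutations_of_set {..<n}. separable n k xs} \<le> card (\<Union>(A, bs)\<in>\<A> \<times> ?B. ?P A bs)"
    using fin\<A> finite_few_switches by (intro card_mono) auto
  also have "\<dots> \<le> (\<Sum>(A, bs)\<in>\<A> \<times> ?B. card (?P A bs))"
    using card_UN_le[of "\<A> \<times> ?B" "\<lambda>(A, bs). ?P A bs"] fin\<A> finite_few_switches
    by (simp add: case_prod_unfold)
  finally have "real (card {xs \<in> permutations_of_set {..<n}. separable n k xs}) \<le> (\<Sum>(A, bs)\<in>\<A> \<times> ?B. real (card (?P A bs)))"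
    by (simp add: case_prod_unfold flip: of_nat_sum)
  also have "\<dots> \<le> (\<Sum>(A, bs)\<in>\<A> \<times> ?B. ?M)"
  proof (rule sum_mono, clarify)
    fix A bs assume "A \<in> \<A>"
    then have A: "A \<subseteq> {..<n}" "n \<le> 12 * card A" "4 * card A \<le> 3 * n" by (auto simp: \<A>_def)
    have "real (card (?P A bs)) \<le> real (fact (card A) * fact (n - card A))"
      using card_permutations_with_pattern[OF A(1)] of_nat_le_iff by blast
    also have "\<dots> \<le> ?M" using fact_mult_fact_le[OF A(2,3)] by simp
    finally show "real (card (?P A bs)) \<le> ?M" .
  qed
  also have "\<dots> = real (card \<A>) * real (card ?B) * ?M"
    by (simp add: case_prod_unfold card_cartesian_product)
  also have "\<dots> \<le> real (card ?B) * real (card ?B) * ?M"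
    using c\<A> by (intro mult_right_mono) auto
  finally show ?thesis by (simp add: power2_eq_square)
qed

lemma few_separable_permutations:
  "\<exists>\<delta> :: real. 0 < \<delta> \<and>
    (\<lambda>n. real (card {xs \<in> permutations_of_set {..<n}. separable n (nat \<lfloor>\<delta> * real n\<rfloor>) xs}) / fact n)
     \<longlonglongrightarrow> 0"
proof -
  define \<Lambda> :: real where "\<Lambda> = ln (4 / 3) / 12"
  have \<Lambda>: "0 < \<Lambda>" by (simp add: \<Lambda>_def)
  \<comment> \<open>With \<Lambda> the decay rate of (3/4)^(n/12), both (1 + x)^n and x^(-\<delta>
    n) are kept below exp(\<Lambda> n/8). The squared count is then at most 4 exp(\<Lambda> n/2),
    and half of the decay survives.\<close>
  define x where "x = min (1 / 2) (\<Lambda> / 8)"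
  have x: "0 < x" "x < 1" "x \<le> \<Lambda> / 8" using \<Lambda> by (auto simp: x_def)
  have lnx: "ln x < 0" using x by simp
  define \<delta> where "\<delta> = \<Lambda> / (8 * (- ln x))"
  have \<delta>: "0 < \<delta>" "\<delta> * (- ln x) = \<Lambda> / 8" using \<Lambda> lnx by (auto simp: \<delta>_def field_simps)
  let ?p = "\<lambda>n. real (card {xs \<in> permutations_of_set {..<n}. separable n (nat \<lfloor>\<delta> * real n\<rfloor>) xs}) / fact n"
  have bound: "?p n \<le> 4 * exp (- (\<Lambda> / 2)) ^ n" for n
  proof -
    let ?k = "nat \<lfloor>\<delta> * real n\<rfloor>"
    have "(1 + x) ^ n \<le> exp x ^ n" using x exp_ge_add_one_self[of x] by (intro power_mono) auto
    also have "\<dots> = exp (n * x)" by (simp add: exp_of_nat_mult)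
    also have "\<dots> \<le> exp (n * (\<Lambda> / 8))" using x by (intro iffD2[OF exp_le_cancel_iff] mult_left_mono) auto
    finally have 1: "(1 + x) ^ n \<le> exp (n * (\<Lambda> / 8))" .
    have "1 / x ^ ?k = exp (real ?k * (- ln x))"
      using x by (simp add: exp_minus inverse_eq_divide exp_of_nat_mult)
    also have "\<dots> \<le> exp (\<delta> * n * (- ln x))"
      using lnx \<delta> by (intro iffD2[OF exp_le_cancel_iff] mult_right_mono of_nat_floor) auto
    also have "\<delta> * n * (- ln x) = n * (\<Lambda> / 8)" using \<delta>(2) by (metis mult.assoc mult.commute)
    finally have 2: "1 / x ^ ?k \<le> exp (n * (\<Lambda> / 8))" .
    have "real (card (few_switches n ?k)) \<le> 2 * (1 + x) ^ n / x ^ ?k"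
      using x by (intro card_few_switches) auto
    also have "\<dots> = 2 * ((1 + x) ^ n * (1 / x ^ ?k))" by simp
    also have "\<dots> \<le> 2 * (exp (n * (\<Lambda> / 8)) * exp (n * (\<Lambda> / 8)))"
      using 1 2 x by (intro mult_left_mono mult_mono) auto
    finally have 3: "real (card (few_switches n ?k)) \<le> 2 * exp (n * (\<Lambda> / 4))"
      by (simp add: mult.commute flip: exp_add)
    have e: "(3 / 4 :: real) powr (n / 12) = exp (- (n * \<Lambda>))"
    proof -
      have "ln (3 / 4 :: real) = - ln (4 / 3)" by (simp add: ln_div)
      then show ?thesis by (simp add: powr_def \<Lambda>_def)
    qed
    have "?p n \<le> (real (card (few_switches n ?k)))\<^sup>2 * exp (- (n * \<Lambda>))"
      using card_separable[of n ?k] unfolding e by (simp add: field_simps)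
    also have "\<dots> \<le> (2 * exp (n * (\<Lambda> / 4)))\<^sup>2 * exp (- (n * \<Lambda>))"
      using 3 by (intro mult_right_mono power_mono) auto
    also have "\<dots> = 4 * exp (n * (- (\<Lambda> / 2)))"
      by (simp add: power2_eq_square flip: exp_add)
    also have "\<dots> = 4 * exp (- (\<Lambda> / 2)) ^ n" by (subst exp_of_nat_mult) simp
    finally show ?thesis .
  qed
  have "(\<lambda>n. 4 * exp (- (\<Lambda> / 2)) ^ n) \<longlonglongrightarrow> 4 * 0"
    using \<Lambda> by (intro tendsto_mult_left LIMSEQ_power_zero) auto
  then have "?p \<longlonglongrightarrow> 0"
    by (intro tendsto_sandwich[of "\<lambda>_. 0" ?p sequentially "\<lambda>n. 4 * exp (- (\<Lambda> / 2)) ^ n"] always_eventually)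
       (use bound in auto)
  then show ?thesis using \<delta>(1) by (intro exI[of _ \<delta>] conjI)
qed

section \<open>Switches along a first-return permutation\<close>

lemma cyclic_perm_orbit:
  assumes "cyclic_perm N \<tau>" "0 < N"
  shows "bij_betw (\<lambda>k. (\<tau> ^^ k) 0) {..<N} {..<N}" "(\<tau> ^^ N) 0 = 0"
proof -
  have o: "{..<N} = orbit \<tau> 0"
    using assms by (auto simp: cyclic_perm_def cyclic_on_alldef)
  then have self: "0 \<in> orbit \<tau> 0" using assms by auto
  define l where "l = funpow_dist1 \<tau> 0 0"
  have "{..<N} = (\<lambda>k. (\<tau> ^^ k) 0) ` {..<l}"
    using orbit_conv_funpow_dist1[OF self] o by (simp add: l_def lessThan_atLeast0)
  then have bij: "bij_betw (\<lambda>k. (\<tau> ^^ k) 0) {..<l} {..<N}"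
    using inj_on_funpow_dist1[OF self] by (simp add: bij_betw_def l_def lessThan_atLeast0)
  then have "l = N" using bij_betw_same_card by fastforce
  then show "bij_betw (\<lambda>k. (\<tau> ^^ k) 0) {..<N} {..<N}" "(\<tau> ^^ N) 0 = 0"
    using bij funpow_dist1_prop[OF self] by (simp_all add: l_def)
qed

lemma cycle_notation_props:
  assumes "cyclic_perm N \<tau>" "0 < N"
  shows "length (cycle_notation N \<tau>) = N" "distinct (cycle_notation N \<tau>)"
    "set (cycle_notation N \<tau>) = {..<N}"
  using cyclic_perm_orbit(1)[OF assms]
  by (auto simp: cycle_notation_def distinct_map bij_betw_def lessThan_atLeast0)

locale meandric =
  fixes N :: nat and \<tau> :: "nat \<Rightarrow> nat"
  assumes meandric: "cyclic_meandric N \<tau>"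
begin

definition pt :: "nat \<Rightarrow> nat" where "pt k = (\<tau> ^^ k) 0"

definition idx :: "nat \<Rightarrow> nat" where "idx = the_inv_into {..<N} pt"

text \<open>Steps of the curve from even indices are drawn above the line and the others below.
  Hence on side \<open>s\<close> the partner is the next crossing or the previous one, according to
  the parity of the index.\<close>

definition mate :: "bool \<Rightarrow> nat \<Rightarrow> nat" where
  "mate s v = (if even (idx v) = s then \<tau> v else inv \<tau> v)"

lemma N: "even N" "0 < N" and perm: "\<tau> permutes {..<N}" and cyc: "cyclic_perm N \<tau>"
  using meandric by (auto simp: cyclic_meandric_def cyclic_perm_def)

lemma bij_pt: "bij_betw pt {..<N} {..<N}" and pt_N: "(\<tau> ^^ N) 0 = 0"
  using cyclic_perm_orbit[OF cyc N(2)] by (simp_all add: pt_def[abs_def])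

lemma idx_less: "v < N \<Longrightarrow> idx v < N" and pt_idx: "v < N \<Longrightarrow> pt (idx v) = v"
  and idx_pt: "k < N \<Longrightarrow> idx (pt k) = k"
  using bij_pt the_inv_into_into[of pt "{..<N}" v "{..<N}"] f_the_inv_into_f[of pt "{..<N}" v]
    the_inv_into_f_f[of pt "{..<N}" k]
  by (auto simp: bij_betw_def idx_def)

lemma tau_less: "v < N \<Longrightarrow> \<tau> v < N" and inv_less: "v < N \<Longrightarrow> inv \<tau> v < N"
  using permutes_in_image[OF perm] permutes_in_image[OF permutes_inv[OF perm]] by auto

lemma idx_tau: "v < N \<Longrightarrow> idx (\<tau> v) = Suc (idx v) mod N"
proof -
  assume v: "v < N"
  have "\<tau> v = pt (Suc (idx v) mod N)"
  proof (cases "Suc (idx v) = N")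
    case True
    have "\<tau> v = (\<tau> ^^ Suc (idx v)) 0" using pt_idx[OF v] by (simp add: pt_def)
    then show ?thesis using pt_N True by (simp add: pt_def)
  next
    case False
    then have "Suc (idx v) < N" using idx_less[OF v] by simp
    then show ?thesis using pt_idx[OF v] by (simp add: pt_def)
  qed
  then show ?thesis using idx_pt N by simp
qed

text \<open>As \<open>N\<close> is even, parity also alternates at the closing step from index
  \<open>N - 1\<close> to 0.\<close>

lemma parity_tau: "v < N \<Longrightarrow> even (idx (\<tau> v)) \<longleftrightarrow> odd (idx v)"
  using idx_tau[of v] N by (simp add: dvd_mod_iff)

lemma parity_inv: "v < N \<Longrightarrow> even (idx (inv \<tau> v)) \<longleftrightarrow> odd (idx v)"
  using parity_tau[OF inv_less, of v] permutes_inverses(1)[OF perm] by simp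

lemma tau_in_matching:
  assumes v: "v < N"
  shows "{v, \<tau> v} \<in> (if even (idx v) then even_matching else odd_matching) (cycle_notation N \<tau>)"
proof -
  have nth: "cycle_notation N \<tau> ! k = pt k" if "k < N" for k
    using that by (simp add: cycle_notation_def pt_def)
  have len: "length (cycle_notation N \<tau>) = N" by (simp add: cycle_notation_def)
  have t: "\<tau> v = pt (Suc (idx v) mod N)"
    using pt_idx[OF tau_less[OF v]] idx_tau[OF v] by simp
  have i: "idx v < N" "idx v div 2 < N div 2"
    using idx_less[OF v] N by (auto elim!: evenE)
  show ?thesis
  proof (cases "even (idx v)")
    case True
    then have k: "idx v = 2 * (idx v div 2)" "Suc (idx v) < N" using i N by (auto elim!: evenE)
    then have "{v, \<tau> v} = {cycle_notation N \<tau> ! (2 * (idx v div 2)), cycle_notation N \<tau> ! (2 * (idx v div 2) + 1)}"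
      using nth pt_idx[OF v] t i by simp
    also have "\<dots> \<in> even_matching (cycle_notation N \<tau>)"
      unfolding even_matching_def
      by (intro CollectI exI[of _ "idx v div 2"] conjI refl) (use i len in simp)
    finally show ?thesis using True by simp
  next
    case False
    then have k: "idx v = 2 * (idx v div 2) + 1" by simp
    then have "{v, \<tau> v} = {cycle_notation N \<tau> ! (2 * (idx v div 2) + 1),
        cycle_notation N \<tau> ! ((2 * (idx v div 2) + 2) mod length (cycle_notation N \<tau>))}"
      using nth[OF i(1)] nth[of "Suc (idx v) mod N"] pt_idx[OF v] t len N by simp
    also have "\<dots> \<in> odd_matching (cycle_notation N \<tau>)"
      unfolding odd_matching_def
      by (intro CollectI exI[of _ "idx v div 2"] conjI refl) (use i len in simp)
    finally show ?thesis using False by simp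
  qed
qed

lemma mate_in_matching:
  assumes v: "v < N"
  shows "{v, mate s v} \<in> (if s then even_matching else odd_matching) (cycle_notation N \<tau>)"
proof (cases "even (idx v) = s")
  case True
  then show ?thesis using tau_in_matching[OF v] by (auto simp: mate_def)
next
  case False
  then show ?thesis
    using tau_in_matching[OF inv_less[OF v]] parity_inv[OF v] permutes_inverses(1)[OF perm, of v]
    by (auto simp: mate_def insert_commute split: if_splits)
qed

sublocale meander_system N mate
proof (unfold_locales)
  fix s v
  show "0 < N" by (rule N)
  assume v: "v < N"
  show "mate s v < N" using tau_less inv_less v by (auto simp: mate_def)
  show "mate s (mate s v) = v"
    using parity_tau[OF v] parity_inv[OF v] permutes_inverses[OF perm] by (auto simp: mate_def)
  show "mate s v \<noteq> v" using parity_tau[OF v] parity_inv[OF v] by (auto simp: mate_def)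
next
  fix s a b
  assume ab: "a < N" "b < N" "a < b" "b < mate s a"
  have "noncrossing ((if s then even_matching else odd_matching) (cycle_notation N \<tau>))"
    using meandric by (auto simp: cyclic_meandric_def)
  then show "\<not> mate s a < mate s b"
    using mate_in_matching[OF ab(1), of s] mate_in_matching[OF ab(2), of s] ab(3,4)
    unfolding noncrossing_def by blast
qed

lemma card_line_changes:
  "card {i. Suc i < N \<and> (i \<in> X) \<noteq> (Suc i \<in> X)} \<le> card (cut_edges src tgt edges X)"
proof (rule card_inj_on_le[of Line])
  show "finite (cut_edges src tgt edges X)" by (auto simp: cut_edges_def edges_UNIV)
qed (auto simp: inj_on_def cut_edges_def edges_def)

text \<open>Each step of the curve is charged to the arc that carries it. Two steps cannot share an
  arc: its side fixes the parity of the starting index, and reversing the step would change that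
  parity.\<close>

lemma card_curve_changes:
  "card {v \<in> {..<N}. (v \<in> X) \<noteq> (\<tau> v \<in> X)} \<le> card (cut_edges src tgt edges X)"
proof (rule card_inj_on_le[of "\<lambda>v. arc_at (even (idx v)) v"])
  have mate: "mate (even (idx v)) v = \<tau> v" for v by (simp add: mate_def)
  have ends: "{src (arc_at (even (idx v)) v), tgt (arc_at (even (idx v)) v)} = {v, \<tau> v}" if "v < N" for v
    using P.m_m[OF that, of "even (idx v)"] mate by (auto simp: arc_at_def)
  show "inj_on (\<lambda>v. arc_at (even (idx v)) v) {v \<in> {..<N}. (v \<in> X) \<noteq> (\<tau> v \<in> X)}"
  proof (rule inj_onI)
    fix v w assume vw: "v \<in> {v \<in> {..<N}. (v \<in> X) \<noteq> (\<tau> v \<in> X)}" "w \<in> {v \<in> {..<N}. (v \<in> X) \<noteq> (\<tau> v \<in> X)}"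
      and eq: "arc_at (even (idx v)) v = arc_at (even (idx w)) w"
    then have "even (idx v) = even (idx w)" by (simp add: arc_at_def)
    moreover have "{v, \<tau> v} = {w, \<tau> w}" using ends[of v] ends[of w] vw eq by simp
    ultimately show "v = w" using parity_tau[of v] parity_tau[of w] vw by (auto simp: doubleton_eq_iff)
  qed
  show "finite (cut_edges src tgt edges X)" by (auto simp: cut_edges_def edges_UNIV)
  show "(\<lambda>v. arc_at (even (idx v)) v) ` {v \<in> {..<N}. (v \<in> X) \<noteq> (\<tau> v \<in> X)} \<subseteq> cut_edges src tgt edges X"
    using ends arc_at(1) by (fastforce simp: cut_edges_def doubleton_eq_iff)
qed

lemma separator:
  assumes "S \<subseteq> {..<N}" "30 \<le> card S" "N \<le> h\<^sup>2"
  shows "\<exists>X\<subseteq>{..<N}. card S \<le> 12 * card (X \<inter> S) \<and> 4 * card (X \<inter> S) \<le> 3 * card S \<and>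
    card {i. Suc i < N \<and> (i \<in> X) \<noteq> (Suc i \<in> X)} \<le> 30 * h \<and>
    card {v \<in> {..<N}. (v \<in> X) \<noteq> (\<tau> v \<in> X)} \<le> 30 * h"
proof -
  obtain X where "X \<subseteq> {..<N}" "card S \<le> 12 * card (X \<inter> S)" "4 * card (X \<inter> S) \<le> 3 * card S"
      "card (cut_edges src tgt edges X) \<le> 30 * h"
    using plane_graph.balanced_separator[OF plane_graph assms(1,2), of h] assms(3) by auto
  then show ?thesis using card_line_changes[of X] card_curve_changes[of X] by (meson order.trans)
qed

end

section \<open>Passing from cycles to lists and relabelled subsets\<close>

lemma cycle_of_list_nth:
  assumes "distinct xs" "i < length xs"
  shows "cycle_of_list xs (xs ! i) = xs ! (Suc i mod length xs)"
proof -
  have "map (cycle_of_list xs) xs ! i = rotate 1 xs ! i" using cyclic_rotation[OF assms(1), of 1] by simp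
  then show ?thesis using assms nth_rotate[of i xs 1] by simp
qed

lemma switches_le_card_changes:
  assumes "distinct xs" "set xs \<subseteq> D" "finite D"
    and step: "\<And>i. Suc i < length xs \<Longrightarrow> f (xs ! i) = xs ! Suc i"
  shows "switches (map (\<lambda>v. v \<in> X) xs) \<le> card {v \<in> D. (v \<in> X) \<noteq> (f v \<in> X)}"
  unfolding switches_conv_card
proof (rule card_inj_on_le[of "(!) xs"])
  show "inj_on ((!) xs) {i. Suc i < length (map (\<lambda>v. v \<in> X) xs) \<and>
      map (\<lambda>v. v \<in> X) xs ! i \<noteq> map (\<lambda>v. v \<in> X) xs ! Suc i}"
    using assms(1) by (auto simp: inj_on_def nth_eq_iff_index_eq)
  have "xs ! i \<in> D" if "i < length xs" for i using that assms(2) nth_mem by blast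
  then show "(!) xs ` {i. Suc i < length (map (\<lambda>v. v \<in> X) xs) \<and>
      map (\<lambda>v. v \<in> X) xs ! i \<noteq> map (\<lambda>v. v \<in> X) xs ! Suc i} \<subseteq> {v \<in> D. (v \<in> X) \<noteq> (f v \<in> X)}"
    using step by (auto simp: Suc_lessD)
qed (use assms in auto)

text \<open>The extra 1 pays for the closing step from the last entry to the first.\<close>

lemma card_changes_le_switches:
  assumes "distinct ys"
  shows "card {v \<in> set ys. (v \<in> X) \<noteq> (cycle_of_list ys v \<in> X)} \<le> Suc (switches (map (\<lambda>v. v \<in> X) ys))"
proof -
  let ?I = "{i. Suc i < length ys \<and> map (\<lambda>v. v \<in> X) ys ! i \<noteq> map (\<lambda>v. v \<in> X) ys ! Suc i}"
  have fin: "finite ?I" by (rule finite_subset[of _ "{..<length ys}"]) auto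
  have "{v \<in> set ys. (v \<in> X) \<noteq> (cycle_of_list ys v \<in> X)} \<subseteq> (!) ys ` insert (length ys - 1) ?I"
  proof
    fix v assume v: "v \<in> {v \<in> set ys. (v \<in> X) \<noteq> (cycle_of_list ys v \<in> X)}"
    then obtain i where i: "i < length ys" "v = ys ! i" by (auto simp: in_set_conv_nth)
    have "i \<in> insert (length ys - 1) ?I"
    proof (cases "Suc i = length ys")
      case False
      then have "Suc i < length ys" using i by simp
      then show ?thesis using v i cycle_of_list_nth[OF assms i(1)] by simp
    qed auto
    then show "v \<in> (!) ys ` insert (length ys - 1) ?I" using i by blast
  qed
  then have "card {v \<in> set ys. (v \<in> X) \<noteq> (cycle_of_list ys v \<in> X)} \<le> card ((!) ys ` insert (length ys - 1) ?I)"
    using fin by (intro card_mono) auto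
  also have "\<dots> \<le> card (insert (length ys - 1) ?I)" using fin by (intro card_image_le) auto
  also have "\<dots> \<le> Suc (card ?I)" using fin by (simp add: card_insert_if)
  finally show ?thesis by (simp add: switches_conv_card)
qed

definition rank :: "nat set \<Rightarrow> nat \<Rightarrow> nat" where
  "rank S x = card {y \<in> S. y < x}"

lemma rank_mono: "finite S \<Longrightarrow> x \<in> S \<Longrightarrow> x < y \<Longrightarrow> rank S x < rank S y"
  unfolding rank_def by (intro psubset_card_mono) auto

lemma inj_on_rank: "finite S \<Longrightarrow> inj_on (rank S) S"
  by (rule linorder_inj_onI) (use rank_mono in force)+

lemma rank_image: "finite S \<Longrightarrow> rank S ` S = {..<card S}"
proof (rule card_subset_eq)
  assume S: "finite S"
  show "rank S ` S \<subseteq> {..<card S}"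
    unfolding rank_def using S by (auto intro!: psubset_card_mono)
  show "card (rank S ` S) = card {..<card S}" using card_image[OF inj_on_rank[OF S]] by simp
qed simp

lemma first_return_separable:
  assumes \<tau>: "cyclic_meandric N \<tau>" and S: "S \<subseteq> {..<N}" "card S = n" "30 \<le> n"
    and h: "N \<le> h\<^sup>2" and xs: "xs \<in> permutations_of_set {..<n}"
    and eq: "first_return N \<tau> S = cycle_of_list xs"
  shows "separable n (30 * h + 1) xs"
proof -
  interpret meandric N \<tau> by standard (rule \<tau>)
  have finS: "finite S" using S finite_subset by blast
  obtain X where X: "X \<subseteq> {..<N}" "n \<le> 12 * card (X \<inter> S)" "4 * card (X \<inter> S) \<le> 3 * n"
    and line: "card {i. Suc i < N \<and> (i \<in> X) \<noteq> (Suc i \<in> X)} \<le> 30 * h"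
    and curve: "card {v \<in> {..<N}. (v \<in> X) \<noteq> (\<tau> v \<in> X)} \<le> 30 * h"
    using separator[OF S(1) _ h] S by auto
  have S_eq: "{x. x < N \<and> x \<in> S} = S" using S(1) by auto
  define A where "A = rank S ` (X \<inter> S)"
  have rank_A: "rank S x \<in> A \<longleftrightarrow> x \<in> X" if "x \<in> S" for x
    using inj_on_rank[OF finS] that by (auto simp: A_def inj_on_def)
  have map_A: "map (\<lambda>i. i \<in> A) (map (rank S) (filter (\<lambda>x. x \<in> S) zs))
      = map (\<lambda>i. i \<in> X) (filter (\<lambda>x. x \<in> S) zs)" for zs
    using rank_A by auto
  have cA: "card A = card (X \<inter> S)"
    unfolding A_def using inj_on_rank[OF finS] by (intro card_image) (auto simp: inj_on_def)
  have AN: "A \<subseteq> {..<n}" using rank_image[OF finS] S(2) by (auto simp: A_def)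
  have "sorted (map (rank S) (filter (\<lambda>x. x \<in> S) [0..<N]))"
    unfolding sorted_map
    by (rule sorted_wrt_mono_rel[OF _ strict_sorted_iff[THEN iffD2]])
       (use rank_mono[OF finS] in \<open>auto simp: less_imp_le intro: sorted_wrt_filter\<close>)
  moreover have "distinct (map (rank S) (filter (\<lambda>x. x \<in> S) [0..<N]))"
    using inj_on_rank[OF finS] by (auto simp: distinct_map inj_on_def)
  moreover have "set (map (rank S) (filter (\<lambda>x. x \<in> S) [0..<N])) = {..<n}"
    using rank_image[OF finS] S(2) S_eq by (simp add: lessThan_atLeast0)
  ultimately have "map (rank S) (filter (\<lambda>x. x \<in> S) [0..<N]) = [0..<n]"
    by (intro sorted_distinct_set_unique) auto
  then have "switches (map (\<lambda>i. i \<in> A) [0..<n]) \<le> switches (map (\<lambda>i. i \<in> X) [0..<N])"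
    using map_A[of "[0..<N]"] switches_filter_le by metis
  also have "\<dots> = card {i. Suc i < N \<and> (i \<in> X) \<noteq> (Suc i \<in> X)}"
    unfolding switches_conv_card by (rule arg_cong[of _ _ card]) auto
  finally have 1: "switches (map (\<lambda>i. i \<in> A) [0..<n]) \<le> 30 * h + 1" using line by simp

  define ts where "ts = cycle_notation N \<tau>"
  note ts = cycle_notation_props[OF cyc N(2), folded ts_def]
  define ys where "ys = map (rank S) (filter (\<lambda>x. x \<in> S) ts)"
  have ys: "distinct ys" "set ys = {..<n}"
    using ts(2) inj_on_rank[OF finS] rank_image[OF finS] S(2) S_eq
    by (simp_all add: ys_def distinct_map ts(3) inj_on_def)
  have eq': "cycle_of_list xs = cycle_of_list ys"
    using eq by (simp add: first_return_def ys_def ts_def rank_def[abs_def])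
  have "switches (map (\<lambda>i. i \<in> A) ys) \<le> switches (map (\<lambda>i. i \<in> X) ts)"
    unfolding ys_def map_A by (rule switches_filter_le)
  also have "\<dots> \<le> card {v \<in> {..<N}. (v \<in> X) \<noteq> (\<tau> v \<in> X)}"
    using ts by (intro switches_le_card_changes) (auto simp: ts_def cycle_notation_def)
  also have "\<dots> \<le> 30 * h" by (rule curve)
  finally have "switches (map (\<lambda>i. i \<in> A) ys) \<le> 30 * h" .
  \<comment> \<open>\<open>xs\<close> and \<open>ys\<close> are only known to induce the same cyclic
    permutation. They are compared through the elements at which this permutation enters or leaves
    \<open>A\<close>, a count independent of the starting point.\<close>
  moreover have "switches (map (\<lambda>i. i \<in> A) xs) \<le> card {v \<in> set ys. (v \<in> A) \<noteq> (cycle_of_list ys v \<in> A)}"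
    unfolding eq'[symmetric] using xs ys cycle_of_list_nth[of xs]
    by (intro switches_le_card_changes) (auto simp: permutations_of_set_def)
  ultimately have 2: "switches (map (\<lambda>i. i \<in> A) xs) \<le> 30 * h + 1"
    using card_changes_le_switches[OF ys(1), of A] by simp
  show ?thesis unfolding separable_def using 1 2 X cA AN by auto
qed

section \<open>The grid meander\<close>

lemma funpow_cycle_of_list:
  assumes "distinct ts" "ts \<noteq> []"
  shows "(cycle_of_list ts ^^ k) (ts ! 0) = ts ! (k mod length ts)"
proof -
  have "map (cycle_of_list ts ^^ k) ts ! 0 = rotate k ts ! 0" using cyclic_rotation[OF assms(1), of k] by simp
  then show ?thesis using assms nth_rotate[of 0 ts k] by simp
qed

lemma cyclic_perm_cycle_of_list:
  assumes "distinct ts" "set ts = {..<N}" "0 < N"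
  shows "cyclic_perm N (cycle_of_list ts)"
proof -
  let ?\<tau> = "cycle_of_list ts"
  have "0 \<in> set ts" using assms(2,3) by simp
  then have ne: "ts \<noteq> []" by (cases ts) simp_all
  have "orbit ?\<tau> (ts ! 0) = {(?\<tau> ^^ k) (ts ! 0) | k. True}"
    by (rule orbit_altdef_permutation[OF permutation_of_cycle])
  also have "\<dots> = {ts ! (k mod length ts) | k. True}"
    using funpow_cycle_of_list[OF assms(1) ne] by simp
  also have "\<dots> = set ts"
  proof -
    have "ts ! i \<in> {ts ! (k mod length ts) | k. True}" if "i < length ts" for i
      using that by (intro CollectI exI[of _ i]) simp
    moreover have "ts ! (k mod length ts) \<in> set ts" for k using ne by simp
    ultimately show ?thesis by (auto simp: in_set_conv_nth)
  qed
  finally have "{..<N} = orbit ?\<tau> (ts ! 0)" using assms by simp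
  moreover have "ts ! 0 \<in> {..<N}" using ne assms(2) nth_mem by blast
  ultimately have "cyclic_on ?\<tau> {..<N}" by (auto simp: cyclic_on_def)
  then show ?thesis using cycle_permutes[of ts] assms by (simp add: cyclic_perm_def)
qed

lemma cycle_notation_cycle_of_list:
  assumes "distinct ts" "length ts = N" "ts ! 0 = 0" "0 < N"
  shows "cycle_notation N (cycle_of_list ts) = ts"
proof -
  have "ts \<noteq> []" using assms(2,4) by (cases ts) simp_all
  then show ?thesis
    using funpow_cycle_of_list[of ts] assms by (intro nth_equalityI) (auto simp: cycle_notation_def)
qed

text \<open>
  \<open>snake M i j\<close> is the position on the line of the crossing in row \<open>i\<close> and column \<open>j\<close>; by symmetry,
  \<open>snake M j i\<close> is its position on the curve, so \<open>turn M\<close> translates between the two positions.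
\<close>

definition snake :: "nat \<Rightarrow> nat \<Rightarrow> nat \<Rightarrow> nat" where
  "snake M i j = i * M + (if even i then j else M - 1 - j)"

definition turn :: "nat \<Rightarrow> nat \<Rightarrow> nat" where
  "turn M t = snake M (if even (t div M) then t mod M else M - 1 - t mod M) (t div M)"

lemma snake_less: "i < M \<Longrightarrow> j < M \<Longrightarrow> snake M i j < M * M"
proof -
  assume ij: "i < M" "j < M"
  then have "snake M i j < Suc i * M" by (auto simp: snake_def)
  also have "\<dots> \<le> M * M" using ij by (intro mult_right_mono) auto
  finally show ?thesis .
qed

lemma snake_div [simp]: "j < M \<Longrightarrow> snake M i j div M = i"
  by (simp add: snake_def)

lemma snake_mod: "j < M \<Longrightarrow> snake M i j mod M = (if even i then j else M - 1 - j)"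
  unfolding snake_def by (subst mod_mult_self3) auto

lemma turn_snake: "i < M \<Longrightarrow> j < M \<Longrightarrow> turn M (snake M i j) = snake M j i"
  by (simp add: turn_def snake_mod)

lemma turn_eq: "q < M \<Longrightarrow> turn M (j * M + q) = snake M (if even j then q else M - 1 - q) j"
  by (simp add: turn_def)

lemma div_less_square: "t < M * M \<Longrightarrow> t div M < (M :: nat)"
  by (simp add: less_mult_imp_div_less)

lemma snake_cases:
  assumes "t < M * M"
  obtains i j where "i < M" "j < M" "t = snake M i j"
proof -
  have M: "0 < M" using assms by (cases M) auto
  have q: "t mod M < M" using M by simp
  show thesis
  proof (rule that)
    show "t div M < M" using assms by (rule div_less_square)
    show "(if even (t div M) then t mod M else M - 1 - t mod M) < M" using q by auto
    have "t = t div M * M + t mod M" by simp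
    then show "t = snake M (t div M) (if even (t div M) then t mod M else M - 1 - t mod M)"
      using q unfolding snake_def by auto
  qed
qed

definition grid_list :: "nat \<Rightarrow> nat list" where
  "grid_list M = map (turn M) [0..<M * M]"

text \<open>In grid coordinates \<open>turn\<close> transposes rows and columns.\<close>

lemma turn_turn: "t < M * M \<Longrightarrow> turn M (turn M t) = t"
  by (erule snake_cases) (simp add: turn_snake)

lemma turn_less: "t < M * M \<Longrightarrow> turn M t < M * M"
  by (erule snake_cases) (simp add: turn_snake snake_less)

lemma bij_turn: "bij_betw (turn M) {..<M * M} {..<M * M}"
  by (rule bij_betw_byWitness[of _ "turn M"]) (auto simp: turn_turn turn_less)

lemma grid_list:
  "length (grid_list M) = M * M" "distinct (grid_list M)" "set (grid_list M) = {..<M * M}"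
  using bij_turn[of M] by (auto simp: grid_list_def distinct_map bij_betw_def lessThan_atLeast0)

lemma grid_list_0: "0 < M \<Longrightarrow> grid_list M ! 0 = 0"
  using turn_eq[of 0 M 0] by (simp add: grid_list_def snake_def)

text \<open>
  \<open>nested s D a b\<close>: the pair \<open>{a, b}\<close> belongs to the concentric arcs filling one of the blocks of
  length \<open>D\<close> that start at \<open>s\<close>, \<open>s + D\<close>, \<open>s + 2D\<close>, \<open>\<dots>\<close>.
\<close>

definition nested :: "nat \<Rightarrow> nat \<Rightarrow> nat \<Rightarrow> nat \<Rightarrow> bool" where
  "nested s D a b \<longleftrightarrow> (\<exists>c. s + c * D \<le> a \<and> s + c * D \<le> b \<and> Suc (a + b) = 2 * (s + c * D) + D)"

lemma nested_sym: "nested s D a b \<longleftrightarrow> nested s D b a"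
  by (auto simp: nested_def add.commute)

lemma nested_not_crossing:
  assumes "nested s D a1 b1" "nested s D a2 b2" "a1 < a2" "a2 < b1" "b1 < b2"
  shows False
proof -
  from assms obtain c1 c2 where
    c1: "s + c1 * D \<le> a1" "s + c1 * D \<le> b1" "Suc (a1 + b1) = 2 * (s + c1 * D) + D" and
    c2: "s + c2 * D \<le> a2" "s + c2 * D \<le> b2" "Suc (a2 + b2) = 2 * (s + c2 * D) + D"
    by (auto simp: nested_def)
  consider "c1 = c2" | "Suc c1 * D \<le> c2 * D" | "Suc c2 * D \<le> c1 * D"
    by (metis Suc_leI linorder_neqE_nat mult_le_mono1)
  then show False
    using c1 c2 assms(3-5) by cases auto
qed

text \<open>A step within a column joins rows \<open>r\<close> and \<open>r + 1\<close>, which the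
  line traverses in opposite directions; such pairs, over all columns, are concentric. In odd
  columns \<open>r\<close> is \<open>M - 2 - q\<close>, and even \<open>M\<close> preserves its
  parity.\<close>

lemma grid_step:
  assumes "q + 1 < M" "j < M" "even M"
  shows "nested (if even q then 0 else M) (2 * M) (turn M (j * M + q)) (turn M (j * M + (q + 1)))"
proof -
  define r where "r = (if even j then q else M - 2 - q)"
  have r: "r + 1 < M" "even r = even q" using assms by (auto simp: r_def)
  have "{turn M (j * M + q), turn M (j * M + (q + 1))} = {snake M r j, snake M (r + 1) j}"
  proof (cases "even j")
    case False
    then have "M - 1 - q = r + 1" "M - 1 - (q + 1) = r" using assms(1) by (auto simp: r_def)
    then show ?thesis
      using False turn_eq[of q M j] turn_eq[OF assms(1), of j] assms(1)
      by (simp only: if_False insert_commute)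
  next
    case True
    then show ?thesis using turn_eq[of q M j] turn_eq[OF assms(1), of j] assms(1) by (simp add: r_def)
  qed
  moreover have "nested (if even q then 0 else M) (2 * M) (snake M r j) (snake M (r + 1) j)"
  proof (cases "even q")
    case True
    then obtain u where "r = 2 * u" using r by (auto elim: evenE)
    then show ?thesis using True assms unfolding nested_def snake_def
      by (intro exI[of _ u]) (auto simp: algebra_simps)
  next
    case False
    then obtain u where "r = 2 * u + 1" using r by (auto elim: oddE)
    then show ?thesis using False assms unfolding nested_def snake_def
      by (intro exI[of _ u]) (auto simp: algebra_simps)
  qed
  ultimately show ?thesis using nested_sym by (auto simp: doubleton_eq_iff)
qed

text \<open>Since \<open>M\<close> is even, the pairs starting at an even curve position never
  straddle a change of column.\<close>

lemma noncrossing_even_grid: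
  assumes "even M"
  shows "noncrossing (even_matching (grid_list M))"
proof -
  have "nested 0 (2 * M) a b" if "{a, b} \<in> even_matching (grid_list M)" for a b
  proof -
    from that obtain i where
      "i < length (grid_list M) div 2" "{a, b} = {grid_list M ! (2 * i), grid_list M ! (2 * i + 1)}"
      unfolding even_matching_def by blast
    note i = this[unfolded grid_list(1)]
    then have t: "2 * i + 1 < M * M" using assms by (auto elim!: evenE)
    let ?j = "2 * i div M" and ?q = "2 * i mod M"
    have q: "even ?q" "?q < M" using assms t by (auto simp: dvd_mod_iff intro!: mod_less_divisor gr0I)
    then have q1: "?q + 1 < M" using assms by (metis Suc_eq_plus1 Suc_lessI even_Suc)
    have j: "?j < M" using t by (intro div_less_square) simp
    have e: "?j * M + ?q = 2 * i" "?j * M + (?q + 1) = 2 * i + 1"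
      using div_mult_mod_eq[of "2 * i" M] by linarith+
    have "nested 0 (2 * M) (turn M (2 * i)) (turn M (2 * i + 1))"
      using grid_step[OF q1 j assms] q(1) unfolding e by simp
    moreover have "{a, b} = {turn M (2 * i), turn M (2 * i + 1)}" using i(2) t by (simp add: grid_list_def)
    ultimately show ?thesis using nested_sym by (auto simp: doubleton_eq_iff)
  qed
  then show ?thesis unfolding noncrossing_def using nested_not_crossing by blast
qed

text \<open>Besides steps within a column there are changes of column, which join neighbours on the
  line and so cross nothing, and the closing arc over row 0, which lies before all the nested
  blocks.\<close>

lemma noncrossing_odd_grid:
  assumes M: "even M"
  shows "noncrossing (odd_matching (grid_list M))"
proof -
  have *: "nested M (2 * M) a b \<or> b = Suc a \<or> a = Suc b \<or> {a, b} = {0, M - 1}"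
    if "{a, b} \<in> odd_matching (grid_list M)" for a b
  proof -
    from that obtain i where "i < length (grid_list M) div 2"
        "{a, b} = {grid_list M ! (2 * i + 1), grid_list M ! ((2 * i + 2) mod length (grid_list M))}"
      unfolding odd_matching_def by blast
    note i = this[unfolded grid_list(1)]
    define t where "t = 2 * i + 1"
    have t: "t < M * M" "odd t" using i M by (auto simp: t_def elim!: evenE)
    then have M0: "0 < M" by (cases M) auto
    define j q where "j = t div M" and "q = t mod M"
    have jq: "t = j * M + q" "q < M" using M0 by (simp_all add: j_def q_def)
    have j: "j < M" unfolding j_def using t(1) by (rule div_less_square)
    have oq: "odd q" using t(2) M by (simp add: q_def dvd_mod_iff)
    have "{a, b} = {grid_list M ! t, grid_list M ! (Suc t mod (M * M))}" using i(2) by (simp add: t_def)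
    then have ab: "{a, b} = {turn M t, turn M (Suc t mod (M * M))}"
      using t M0 by (simp add: grid_list_def)
    consider "q + 1 < M" | "q = M - 1" "j + 1 < M" | "q = M - 1" "j = M - 1" using jq(2) j by linarith
    then show ?thesis
    proof cases
      case 1
      have "Suc t < M * M"
      proof -
        have "Suc t < Suc j * M" using 1 jq by simp
        also have "\<dots> \<le> M * M" using j by (intro mult_right_mono) auto
        finally show ?thesis .
      qed
      then have "{a, b} = {turn M (j * M + q), turn M (j * M + (q + 1))}" using ab jq by simp
      then show ?thesis using grid_step[OF 1 j M] oq nested_sym by (auto simp: doubleton_eq_iff)
    next
      case 2
      then have st: "Suc t = Suc j * M + 0" using jq M0 by simp
      have "Suc j * M < M * M" using 2 M0 by (intro mult_strict_right_mono) auto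
      then have "{a, b} = {turn M (j * M + (M - 1)), turn M (Suc j * M + 0)}" using ab 2 jq st by (simp add: add.commute)
      also have "turn M (j * M + (M - 1)) = snake M (if even j then M - 1 else 0) j"
        using turn_eq[of "M - 1" M j] M0 by simp
      also have "turn M (Suc j * M + 0) = snake M (if even j then M - 1 else 0) (Suc j)"
        using turn_eq[OF M0, of "Suc j"] by simp
      also have "{snake M (if even j then M - 1 else 0) j, snake M (if even j then M - 1 else 0) (Suc j)}
          = (if even j then {(M - 1) * M + Suc (M - 1 - Suc j), (M - 1) * M + (M - 1 - Suc j)} else {j, Suc j})"
      proof -
        have "odd (M - 1)" "Suc (M - 1 - Suc j) = M - 1 - j" using M M0 2 by auto
        then show ?thesis unfolding snake_def by (simp only: if_False if_True split: if_splits) simp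
      qed
      finally show ?thesis by (cases "even j") (auto simp: doubleton_eq_iff)
    next
      case 3
      then have st: "Suc t = M * M" using jq M0 by (cases M) auto
      have "{a, b} = {turn M (j * M + (M - 1)), turn M (0 * M + 0)}" using ab 3 jq st by simp
      also have "turn M (j * M + (M - 1)) = M - 1"
        using turn_eq[of "M - 1" M j] 3 M M0 by (simp add: snake_def)
      also have "turn M (0 * M + 0) = 0"
        using turn_eq[OF M0, of 0] by (simp add: snake_def)
      finally show ?thesis by (simp add: insert_commute)
    qed
  qed
  show ?thesis
    unfolding noncrossing_def
  proof clarify
    fix a1 b1 a2 b2
    assume P: "{a1, b1} \<in> odd_matching (grid_list M)" "{a2, b2} \<in> odd_matching (grid_list M)"
      and cr: "a1 < a2" "a2 < b1" "b1 < b2"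
    have low: "M \<le> x" if "nested M (2 * M) x y" for x y
      using that by (auto simp: nested_def)
    consider "nested M (2 * M) a1 b1" "nested M (2 * M) a2 b2" | "{a1, b1} = {0, M - 1}" | "{a2, b2} = {0, M - 1}"
      using *[OF P(1)] *[OF P(2)] cr by auto
    then show False
    proof cases
      case 1
      then show False using nested_not_crossing cr by blast
    next
      case 2
      then have "a1 = 0" "b1 = M - 1" using cr by (auto simp: doubleton_eq_iff)
      then show False using *[OF P(2)] low[of a2 b2] cr by (auto simp: doubleton_eq_iff)
    next
      case 3
      then show False using cr by (auto simp: doubleton_eq_iff)
    qed
  qed
qed

lemma cyclic_meandric_grid:
  assumes "even M" "0 < M"
  shows "cyclic_meandric (M * M) (cycle_of_list (grid_list M))"
    and "cycle_notation (M * M) (cycle_of_list (grid_list M)) = grid_list M"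
proof -
  show "cycle_notation (M * M) (cycle_of_list (grid_list M)) = grid_list M"
    using grid_list grid_list_0 assms by (intro cycle_notation_cycle_of_list) auto
  then show "cyclic_meandric (M * M) (cycle_of_list (grid_list M))"
    using assms grid_list noncrossing_even_grid noncrossing_odd_grid
    by (auto simp: cyclic_meandric_def intro!: cyclic_perm_cycle_of_list)
qed

text \<open>The curve meets the marked crossings in the order of their columns. Each of the rows 0,
  ..., n - 1 has exactly one mark and the line passes the rows in order, so relabelling turns the
  mark in column \<open>j\<close> into its row \<open>xs ! j\<close>.\<close>

lemma grid_first_return:
  assumes xs: "xs \<in> permutations_of_set {..<n}" and M: "n \<le> M" "even M" "0 < M"
  defines "S \<equiv> (\<lambda>j. snake M (xs ! j) j) ` {..<n}"
  shows "S \<subseteq> {..<M * M}" "card S = n"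
    "first_return (M * M) (cycle_of_list (grid_list M)) S = cycle_of_list xs"
proof -
  have len: "length xs = n" using xs by (simp add: length_finite_permutations_of_set)
  have set: "set xs = {..<n}" and dist: "distinct xs" using xs by (auto simp: permutations_of_set_def)
  have less: "xs ! j < n" if "j < n" for j using that set len nth_mem by blast
  have lessM: "xs ! j < M" "j < M" if "j < n" for j using less[OF that] that M by auto
  show SN: "S \<subseteq> {..<M * M}" using lessM by (auto simp: S_def snake_less)
  have inj: "inj_on (\<lambda>j. snake M (xs ! j) j) {..<n}"
  proof (rule inj_onI)
    fix i j assume ij: "i \<in> {..<n}" "j \<in> {..<n}" "snake M (xs ! i) i = snake M (xs ! j) j"
    have "xs ! i = snake M (xs ! i) i div M" using ij(1) lessM by simp
    also have "\<dots> = xs ! j" unfolding ij(3) using ij(2) lessM by simp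
    finally show "i = j" using ij dist len by (simp add: nth_eq_iff_index_eq)
  qed
  show "card S = n" using card_image[OF inj] by (simp add: S_def)
  \<comment> \<open>The positions of the marks along the curve, increasing with the column.\<close>
  let ?T = "map (\<lambda>j. snake M j (xs ! j)) [0..<n]"
  have "sorted_wrt (<) ?T"
    unfolding sorted_wrt_map
  proof (rule sorted_wrt_mono_rel[OF _ sorted_wrt_upt])
    fix i j assume ij: "i \<in> set [0..<n]" "j \<in> set [0..<n]" "i < j"
    have "snake M i (xs ! i) < Suc i * M" using lessM[of i] ij by (auto simp: snake_def)
    also have "\<dots> \<le> j * M" using ij by (intro mult_right_mono) auto
    also have "\<dots> \<le> snake M j (xs ! j)" by (simp add: snake_def)
    finally show "snake M i (xs ! i) < snake M j (xs ! j)" .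
  qed
  then have T: "sorted ?T" "distinct ?T" by (simp_all only: strict_sorted_iff)
  have "filter (\<lambda>t. turn M t \<in> S) [0..<M * M] = ?T"
  proof (rule sorted_distinct_set_unique)
    have "t \<in> set ?T" if t: "t < M * M" "turn M t \<in> S" for t
    proof -
      obtain j where "j < n" "turn M t = snake M (xs ! j) j"
        using t(2) unfolding S_def by (elim imageE) simp
      then have "t = snake M j (xs ! j)" using turn_turn[OF t(1)] turn_snake lessM by metis
      then show ?thesis using \<open>j < n\<close> by auto
    qed
    then show "set (filter (\<lambda>t. turn M t \<in> S) [0..<M * M]) = set ?T"
      using lessM turn_snake snake_less by (auto simp: S_def image_iff)
  qed (use T in \<open>auto simp: sorted_wrt_filter\<close>)
  then have "map (turn M) (filter (\<lambda>t. turn M t \<in> S) [0..<M * M]) = map (\<lambda>j. snake M (xs ! j) j) [0..<n]"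
    using lessM turn_snake by simp
  then have filt: "filter (\<lambda>x. x \<in> S) (grid_list M) = map (\<lambda>j. snake M (xs ! j) j) [0..<n]"
    by (simp add: grid_list_def filter_map o_def)
  have rank: "card {y \<in> S. y < snake M (xs ! j) j} = xs ! j" if j: "j < n" for j
  proof -
    have lt: "snake M (xs ! i) i < snake M (xs ! j) j \<longleftrightarrow> xs ! i < xs ! j" if i: "i < n" for i
    proof
      assume "snake M (xs ! i) i < snake M (xs ! j) j"
      then have "snake M (xs ! i) i div M \<le> snake M (xs ! j) j div M" by (intro div_le_mono) simp
      then have "xs ! i \<le> xs ! j" using lessM i j by simp
      moreover have "xs ! i \<noteq> xs ! j"
        using \<open>snake M (xs ! i) i < snake M (xs ! j) j\<close> i j dist len by (auto simp: nth_eq_iff_index_eq)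
      ultimately show "xs ! i < xs ! j" by simp
    next
      assume "xs ! i < xs ! j"
      then have "snake M (xs ! i) i div M < snake M (xs ! j) j div M" using lessM i j by simp
      then show "snake M (xs ! i) i < snake M (xs ! j) j" by (meson div_le_mono not_le)
    qed
    have "bij_betw (\<lambda>i. snake M (xs ! i) i) {i \<in> {..<n}. xs ! i < xs ! j} {y \<in> S. y < snake M (xs ! j) j}"
    proof (rule bij_betw_imageI)
      show "inj_on (\<lambda>i. snake M (xs ! i) i) {i \<in> {..<n}. xs ! i < xs ! j}"
        using inj by (rule inj_on_subset) auto
      show "(\<lambda>i. snake M (xs ! i) i) ` {i \<in> {..<n}. xs ! i < xs ! j} = {y \<in> S. y < snake M (xs ! j) j}"
        using lt by (force simp: S_def)
    qed
    from bij_betw_same_card[OF this]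
    have c: "card {y \<in> S. y < snake M (xs ! j) j} = card {i \<in> {..<n}. xs ! i < xs ! j}" by simp
    have "bij_betw ((!) xs) {i \<in> {..<n}. xs ! i < xs ! j} {..<xs ! j}"
    proof (rule bij_betw_imageI)
      show "inj_on ((!) xs) {i \<in> {..<n}. xs ! i < xs ! j}"
        using dist len by (auto simp: inj_on_def nth_eq_iff_index_eq)
      have "\<exists>i<n. xs ! i = r" if "r < xs ! j" for r
        using that less[OF j] set len by (metis in_set_conv_nth lessThan_iff order.strict_trans)
      then show "(!) xs ` {i \<in> {..<n}. xs ! i < xs ! j} = {..<xs ! j}" by auto
    qed
    from bij_betw_same_card[OF this]
    show ?thesis using c by simp
  qed
  have "map (\<lambda>x. card {y \<in> S. y < x}) (filter (\<lambda>x. x \<in> S) (grid_list M)) = map ((!) xs) [0..<n]"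
    unfolding filt using rank by simp
  also have "\<dots> = xs" using map_nth[of xs] len by simp
  finally show "first_return (M * M) (cycle_of_list (grid_list M)) S = cycle_of_list xs"
    unfolding first_return_def cyclic_meandric_grid(2)[OF M(2,3)] by simp
qed

text \<open>The grid of side 2n is even for every n and shows that the minimum ranges over a
  nonempty set, so it is attained.\<close>

lemma meander_number_realised:
  assumes xs: "xs \<in> permutations_of_set {..<n}" and n: "0 < n"
  defines "\<mu> \<equiv> meander_number n (cycle_of_list xs)"
  shows "\<mu> \<le> 4 * n\<^sup>2"
    "\<exists>\<tau> S. cyclic_meandric \<mu> \<tau> \<and> S \<subseteq> {..<\<mu>} \<and> card S = n \<and> first_return \<mu> \<tau> S = cycle_of_list xs"
proof -
  let ?P = "\<lambda>N. even N \<and> (\<exists>\<tau> S. cyclic_meandric N \<tau> \<and> S \<subseteq> {..<N} \<and> card S = n \<and>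
                                first_return N \<tau> S = cycle_of_list xs)"
  have M: "n \<le> 2 * n" "even (2 * n)" "0 < 2 * n" using n by auto
  have P: "?P (2 * n * (2 * n))"
  proof (intro conjI exI)
    show "even (2 * n * (2 * n))" by simp
  qed (rule cyclic_meandric_grid(1)[OF M(2,3)] grid_first_return[OF xs M])+
  show "\<mu> \<le> 4 * n\<^sup>2"
    unfolding \<mu>_def meander_number_def using Least_le[of ?P, OF P] by (simp add: power2_eq_square)
  show "\<exists>\<tau> S. cyclic_meandric \<mu> \<tau> \<and> S \<subseteq> {..<\<mu>} \<and> card S = n \<and> first_return \<mu> \<tau> S = cycle_of_list xs"
    unfolding \<mu>_def meander_number_def using LeastI[of ?P, OF P] by blast
qed

section \<open>Typical meander numbers\<close>

lemma separable_mono: "separable n k xs \<Longrightarrow> k \<le> k' \<Longrightarrow> separable n k' xs"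
  unfolding separable_def by (meson order.trans)

lemma cyclic_perm_eq_cycle_of_list:
  assumes "cyclic_perm n \<sigma>" "0 < n"
  shows "cycle_notation n \<sigma> \<in> permutations_of_set {..<n}" "\<sigma> = cycle_of_list (cycle_notation n \<sigma>)"
proof -
  let ?ts = "cycle_notation n \<sigma>"
  note ts = cycle_notation_props[OF assms]
  then show "?ts \<in> permutations_of_set {..<n}" by auto
  have nth: "?ts ! k = (\<sigma> ^^ k) 0" if "k < n" for k
    using that by (simp add: cycle_notation_def)
  show "\<sigma> = cycle_of_list ?ts"
  proof
    fix x
    show "\<sigma> x = cycle_of_list ?ts x"
    proof (cases "x < n")
      case True
      then obtain k where k: "k < n" "x = ?ts ! k" using ts by (metis in_set_conv_nth lessThan_iff)
      then have "cycle_of_list ?ts x = ?ts ! (Suc k mod n)" using cycle_of_list_nth[OF ts(2), of k] ts(1) by simp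
      also have "\<dots> = \<sigma> x"
        using nth[of "Suc k"] nth[of 0] nth[of k] k assms(2) cyclic_perm_orbit(2)[OF assms]
        by (cases "Suc k = n") auto
      finally show ?thesis ..
    next
      case False
      then have "\<sigma> x = x" using assms(1) by (simp add: cyclic_perm_def permutes_def)
      moreover have "cycle_of_list ?ts x = x" using False ts by (intro id_outside_supp) simp
      ultimately show ?thesis by simp
    qed
  qed
qed

lemma meander_number_pos:
  "xs \<in> permutations_of_set {..<n} \<Longrightarrow> 0 < n \<Longrightarrow> 0 < meander_number n (cycle_of_list xs)"
  using meander_number_realised(2) by (fastforce simp: cyclic_meandric_def)

lemma few_small_meander_numbers:
  "\<exists>c :: real. 0 < c \<and> (\<lambda>n. real (card {xs \<in> permutations_of_set {..<n}.
      real (meander_number n (cycle_of_list xs)) < c * real n ^ 2}) / fact n) \<longlonglongrightarrow> 0"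
proof -
  obtain \<delta> :: real where \<delta>: "0 < \<delta>" and lim:
    "(\<lambda>n. real (card {xs \<in> permutations_of_set {..<n}. separable n (nat \<lfloor>\<delta> * real n\<rfloor>) xs}) / fact n) \<longlonglongrightarrow> 0"
    using few_separable_permutations by blast
  \<comment> \<open>Below, \<open>h\<close> is \<open>k div 31\<close> with \<open>k\<close> the
    floor of \<delta> n, since 30h + 1 \<le> 31h. Weakening 1/31 to 1/62 absorbs the roundings once
    \<delta> n \<ge> 64.\<close>
  define c where "c = (\<delta> / 62)\<^sup>2"
  let ?bad = "\<lambda>n. {xs \<in> permutations_of_set {..<n}. real (meander_number n (cycle_of_list xs)) < c * real n ^ 2}"
  let ?sep = "\<lambda>n. {xs \<in> permutations_of_set {..<n}. separable n (nat \<lfloor>\<delta> * real n\<rfloor>) xs}"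
  have sub: "?bad n \<subseteq> ?sep n" if n: "30 \<le> n" "64 / \<delta> \<le> real n" for n
  proof
    fix xs assume "xs \<in> ?bad n"
    then have xs: "xs \<in> permutations_of_set {..<n}" and
      small: "real (meander_number n (cycle_of_list xs)) < c * real n ^ 2" by auto
    define \<mu> where "\<mu> = meander_number n (cycle_of_list xs)"
    define k where "k = nat \<lfloor>\<delta> * real n\<rfloor>"
    define h where "h = k div 31"
    have \<delta>n: "64 \<le> \<delta> * real n" using n \<delta> by (simp add: field_simps)
    have k: "\<delta> * real n - 1 < real k" using \<delta>n unfolding k_def by linarith
    have "real k < 31 * real h + 31"
    proof -
      have "k < 31 * h + 31" unfolding h_def by presburger
      then show ?thesis by linarith
    qed
    then have h: "\<delta> / 62 * real n \<le> real h" using k \<delta>n by linarith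
    then have "1 \<le> h" using \<delta>n by linarith
    have "real \<mu> < (\<delta> / 62 * real n)\<^sup>2"
      using small unfolding \<mu>_def c_def power_mult_distrib .
    also have "\<dots> \<le> (real h)\<^sup>2" using h \<delta> by (intro power_mono) auto
    finally have "\<mu> \<le> h\<^sup>2" by (simp flip: of_nat_power)
    moreover obtain \<tau> S where "cyclic_meandric \<mu> \<tau>" "S \<subseteq> {..<\<mu>}" "card S = n"
        "first_return \<mu> \<tau> S = cycle_of_list xs"
      using meander_number_realised(2)[OF xs] n unfolding \<mu>_def by auto
    ultimately have "separable n (30 * h + 1) xs" using first_return_separable xs n by blast
    moreover have "30 * h + 1 \<le> k" using \<open>1 \<le> h\<close> unfolding h_def by linarith
    ultimately have "separable n k xs" by (rule separable_mono)
    then show "xs \<in> ?sep n" using xs by (simp add: k_def)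
  qed
  have "(\<lambda>n. real (card (?bad n)) / fact n) \<longlonglongrightarrow> 0"
  proof (rule tendsto_sandwich[OF _ _ tendsto_const lim])
    have "\<forall>\<^sub>F n in sequentially. 30 \<le> n \<and> 64 / \<delta> \<le> real n"
      using eventually_ge_at_top[of 30] eventually_ge_at_top[of "nat \<lceil>64 / \<delta>\<rceil>"]
      by eventually_elim linarith
    then show "\<forall>\<^sub>F n in sequentially. real (card (?bad n)) / fact n \<le> real (card (?sep n)) / fact n"
    proof eventually_elim
      case (elim n)
      then have "card (?bad n) \<le> card (?sep n)" using sub by (intro card_mono) auto
      then show ?case by (simp add: divide_right_mono)
    qed
  qed simp
  moreover have "0 < c" using \<delta> by (simp add: c_def)
  ultimately show ?thesis by (intro exI[of _ c] conjI)
qed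

theorem corollary21:
  shows "(\<exists>c C :: real. c > 0 \<and> C > 0 \<and>
            (\<lambda>n. measure_pmf.prob (pmf_of_set (permutations_of_set {..<n}))
                   {xs. c * real n ^ 2 \<le> real (meander_number n (cycle_of_list xs)) \<and>
                        real (meander_number n (cycle_of_list xs)) \<le> C * real n ^ 2})
              \<longlonglongrightarrow> 1 \<and>
            (\<forall>n\<ge>1. \<exists>\<sigma>. cyclic_perm n \<sigma> \<and>
                   c * real n ^ 2 \<le> real (meander_number n \<sigma>) \<and>
                   real (meander_number n \<sigma>) \<le> C * real n ^ 2)) \<and>
         (\<lambda>n. real (max_meander_number n)) \<in> \<Theta>(\<lambda>n. real n ^ 2)"
proof -
  let ?\<mu> = "\<lambda>n xs. real (meander_number n (cycle_of_list xs))"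
  let ?P = "\<lambda>n. permutations_of_set {..<n}"
  have upper: "?\<mu> n xs \<le> 4 * real n ^ 2" if "xs \<in> ?P n" "1 \<le> n" for n xs
  proof -
    have "?\<mu> n xs \<le> real (4 * n ^ 2)"
      using meander_number_realised(1)[OF that(1)] that(2) by (intro of_nat_mono) simp
    then show ?thesis by simp
  qed
  define bad where "bad c n = {xs \<in> ?P n. ?\<mu> n xs < c * real n ^ 2}" for c :: real and n
  obtain c0 :: real where c0: "0 < c0" and lim0: "(\<lambda>n. real (card (bad c0 n)) / fact n) \<longlonglongrightarrow> 0"
    using few_small_meander_numbers by (auto simp: bad_def)
  obtain n0 where n0: "\<And>n. n0 \<le> n \<Longrightarrow> real (card (bad c0 n)) / fact n < 1"
    using order_tendstoD(2)[OF lim0, of 1] unfolding eventually_sequentially by auto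
  \<comment> \<open>The second bound gives c n^2 \<le> 1 for n < n0, where positivity of the meander
    number suffices; existence thus holds for every n \<ge> 1 with the same constant.\<close>
  define c where "c = min c0 (1 / (real n0 + 1) ^ 2)"
  have c: "0 < c" using c0 by (simp add: c_def)
  have bad_mono: "card (bad c n) \<le> card (bad c0 n)" for n
  proof (intro card_mono subsetI)
    fix xs assume "xs \<in> bad c n"
    then have "?\<mu> n xs < c * real n ^ 2" "xs \<in> ?P n" by (auto simp: bad_def)
    moreover have "c * real n ^ 2 \<le> c0 * real n ^ 2" by (intro mult_right_mono) (auto simp: c_def)
    ultimately show "xs \<in> bad c0 n" by (simp add: bad_def)
  qed (simp add: bad_def)
  have lim: "(\<lambda>n. real (card (bad c n)) / fact n) \<longlonglongrightarrow> 0"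
    by (rule tendsto_sandwich[OF _ _ tendsto_const lim0])
       (auto intro!: always_eventually divide_right_mono simp: bad_mono)
  have good: "\<exists>xs\<in>?P n. c * real n ^ 2 \<le> ?\<mu> n xs" if n: "1 \<le> n" for n
  proof (cases "n0 \<le> n")
    case True
    have "real (card (bad c n)) / fact n < 1"
      using n0[OF True] bad_mono[of n] by (smt (verit) divide_right_mono fact_ge_zero of_nat_mono)
    then have "real (card (bad c n)) < real (card (?P n))" by (simp add: divide_less_eq)
    then have "bad c n \<noteq> ?P n" by auto
    then obtain xs where "xs \<in> ?P n" "xs \<notin> bad c n" by (auto simp: bad_def)
    then show ?thesis by (auto simp: bad_def not_less)
  next
    case False
    have xs: "[0..<n] \<in> ?P n" by (auto simp: lessThan_atLeast0)
    have "c * real n ^ 2 \<le> 1 / (real n0 + 1) ^ 2 * (real n0 + 1) ^ 2"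
      using False by (intro mult_mono power_mono) (auto simp: c_def)
    also have "\<dots> = 1" by simp
    also have "1 \<le> ?\<mu> n [0..<n]" using meander_number_pos[OF xs] n by simp
    finally show ?thesis using xs by blast
  qed
  have cyclic: "cyclic_perm n (cycle_of_list xs)" if "xs \<in> ?P n" "1 \<le> n" for n xs
    using that by (intro cyclic_perm_cycle_of_list) (auto simp: permutations_of_set_def)
  let ?G = "\<lambda>n. {xs. c * real n ^ 2 \<le> ?\<mu> n xs \<and> ?\<mu> n xs \<le> 4 * real n ^ 2}"
  have prob: "measure_pmf.prob (pmf_of_set (?P n)) (?G n) = 1 - real (card (bad c n)) / fact n" if "1 \<le> n" for n
  proof -
    have "?P n \<inter> ?G n = ?P n - bad c n" using upper[OF _ that] by (auto simp: bad_def)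
    moreover have "card (?P n - bad c n) = fact n - card (bad c n)"
      by (subst card_Diff_subset) (auto simp: bad_def)
    moreover have "card (bad c n) \<le> fact n"
      using card_mono[of "?P n" "bad c n"] by (auto simp: bad_def)
    ultimately show ?thesis
      by (subst measure_pmf_of_set) (auto simp: of_nat_diff diff_divide_distrib)
  qed
  have "(\<lambda>n. 1 - real (card (bad c n)) / fact n) \<longlonglongrightarrow> 1 - 0"
    by (intro tendsto_diff tendsto_const lim)
  then have "(\<lambda>n. 1 - real (card (bad c n)) / fact n) \<longlonglongrightarrow> 1" by simp
  moreover have "\<forall>\<^sub>F n in sequentially.
      1 - real (card (bad c n)) / fact n = measure_pmf.prob (pmf_of_set (?P n)) (?G n)"
    using eventually_ge_at_top[of 1] by eventually_elim (rule prob[symmetric])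
  ultimately have limit: "(\<lambda>n. measure_pmf.prob (pmf_of_set (?P n)) (?G n)) \<longlonglongrightarrow> 1"
    by (rule Lim_transform_eventually)
  have ex: "\<exists>\<sigma>. cyclic_perm n \<sigma> \<and> c * real n ^ 2 \<le> real (meander_number n \<sigma>) \<and>
      real (meander_number n \<sigma>) \<le> 4 * real n ^ 2" if "1 \<le> n" for n
    using good[OF that] cyclic[OF _ that] upper[OF _ that] by blast
  have max: "c * real n ^ 2 \<le> real (max_meander_number n) \<and> real (max_meander_number n) \<le> 4 * real n ^ 2"
    if n: "1 \<le> n" for n
  proof -
    let ?M = "{meander_number n \<sigma> | \<sigma>. cyclic_perm n \<sigma>}"
    have "?M \<subseteq> meander_number n ` {\<sigma>. \<sigma> permutes {..<n}}" by (auto simp: cyclic_perm_def)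
    then have fin: "finite ?M" by (rule finite_subset) (simp add: finite_permutations)
    obtain \<sigma> where \<sigma>: "cyclic_perm n \<sigma>" "c * real n ^ 2 \<le> real (meander_number n \<sigma>)" using ex[OF n] by blast
    have "meander_number n \<sigma> \<le> max_meander_number n"
      unfolding max_meander_number_def using fin \<sigma>(1) by (intro Max_ge) auto
    moreover have "max_meander_number n \<in> ?M"
      unfolding max_meander_number_def using fin \<sigma>(1) by (intro Max_in) auto
    then obtain \<sigma>' where "cyclic_perm n \<sigma>'" "max_meander_number n = meander_number n \<sigma>'" by blast
    then have "real (max_meander_number n) \<le> 4 * real n ^ 2"
      using cyclic_perm_eq_cycle_of_list[of n \<sigma>'] upper[of "cycle_notation n \<sigma>'" n] n by simp
    ultimately show ?thesis using \<sigma>(2) by linarith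
  qed
  have "(\<lambda>n. real (max_meander_number n)) \<in> \<Theta>(\<lambda>n. real n ^ 2)"
    by (rule bigthetaI'[OF c, of 4])
       (use max in \<open>auto intro: eventually_mono[OF eventually_ge_at_top[of 1]]\<close>)
  moreover have "0 < (4 :: real)" by simp
  ultimately show ?thesis using c limit ex by (intro conjI exI[of _ c] exI[of _ 4]) auto
qed

end
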